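(* Let $G\leq \mathrm{S}_n$ be an almost simple primitive permutation group with socle $T$ and degree $n$, let $H$ be a point stabilizer in $G$, and let $g\in G$. Suppose that: (a) $HgH\neq Hg^{-1}H$; (b) except for $\mathrm{A}_n$ and $\mathrm{S}_n$, each overgroup of $G$ in $\mathrm{S}_n$ has socle $T$; (c) $\mathrm{Aut}(T)$ has a core-free maximal subgroup $K$ containing $H$ such that $\mathrm{Aut}(T)=G(K\cap K^{g})$. Then the bi-coset graph $\mathrm{B}(G,H,H,HgH)$ is semisymmetric with full automorphism group (isomorphic to) $\mathrm{Aut}(T)$.
   Context: All groups and graphs are finite; graphs are undirected and simple. A group $G$ is almost simple with socle $T$ if $T\leq G\leq\mathrm{Aut}(T)$ for some nonabelian simple group $T$ (identified with $\mathrm{Inn}(T)$). $\mathrm{A}_n,\mathrm{S}_n$ are the alternating and symmetric groups of degree $n$; an overgroup of $G$ in $\mathrm{S}_n$ is a subgroup of $\mathrm{S}_n$ containing $G$. $K^g=g^{-1}Kg$. A subgroup is core-free if it contains no nontrivial normal subgroup of the ambient group. Bi-coset graph: for a group $G$, subgroups $L,R$ and a union $D$ of double cosets of $R$ and $L$ in $G$ (sets $RxL$), $\mathrm{B}(G,L,R,D)$ is the bipartite graph whose two parts are the set $[G:L]$ of right cosets of $L$ and the set $[G:R]$ of right cosets of $R$ (regarded as disjoint even when $L=R$), with edge set $\{\{Lx,Rdx\}\mid x\in G,\ d\in D\}$. A graph is semisymmetric if it is regular and its full automorphism group is transitive on the edge set but not on the vertex set. *)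

theory Defs
  imports "HOL-Algebra.Sym_Groups" "HOL-Algebra.SimpleGroups" "HOL-Algebra.Group_Action"
begin

section \<open>Groups\<close>

definition maximal_subgroup :: "'a set \<Rightarrow> ('a, 'b) monoid_scheme \<Rightarrow> bool" where
  "maximal_subgroup M G \<longleftrightarrow>
     subgroup M G \<and> M \<noteq> carrier G \<and>
     (\<forall>N. subgroup N G \<and> M \<subseteq> N \<longrightarrow> N = M \<or> N = carrier G)"

definition core_free :: "'a set \<Rightarrow> ('a, 'b) monoid_scheme \<Rightarrow> bool" where
  "core_free K G \<longleftrightarrow> (\<forall>N. N \<lhd> G \<and> N \<subseteq> K \<longrightarrow> N = {\<one>\<^bsub>G\<^esub>})"

definition minimal_normal :: "'a set \<Rightarrow> ('a, 'b) monoid_scheme \<Rightarrow> bool" where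
  "minimal_normal N G \<longleftrightarrow>
     N \<lhd> G \<and> N \<noteq> {\<one>\<^bsub>G\<^esub>} \<and>
     (\<forall>M. M \<lhd> G \<and> M \<subseteq> N \<longrightarrow> M = {\<one>\<^bsub>G\<^esub>} \<or> M = N)"

definition socle :: "('a, 'b) monoid_scheme \<Rightarrow> 'a set" where
  "socle G = generate G (\<Union>{N. minimal_normal N G})"

definition conj_map :: "('a, 'b) monoid_scheme \<Rightarrow> 'a set \<Rightarrow> 'a \<Rightarrow> 'a \<Rightarrow> 'a" where
  "conj_map G T x = (\<lambda>t\<in>T. x \<otimes>\<^bsub>G\<^esub> t \<otimes>\<^bsub>G\<^esub> inv\<^bsub>G\<^esub> x)"

text \<open>The chain of inclusions from \<open>T\<close> via \<open>G\<close> into \<open>Aut(T)\<close>, with \<open>T\<close> identified with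
  \<open>Inn(T)\<close>, is read as an embedding of \<open>G\<close> into \<open>Aut(T)\<close> sending each \<open>t\<close> in \<open>T\<close> to
  conjugation by \<open>t\<close>. Only the map \<open>conj_map G T\<close> can be such an embedding (see
  \<open>embedding_eq_conj_map\<close> below).\<close>

definition almost_simple_with_socle :: "('a, 'b) monoid_scheme \<Rightarrow> 'a set \<Rightarrow> bool" where
  "almost_simple_with_socle G T \<longleftrightarrow>
     group G \<and> finite (carrier G) \<and> subgroup T G \<and>
     simple_group (G\<lparr>carrier := T\<rparr>) \<and> \<not> comm_group (G\<lparr>carrier := T\<rparr>) \<and>
     conj_map G T \<in> mon G (AutoGroup (G\<lparr>carrier := T\<rparr>))"

lemma embedding_eq_conj_map:
  assumes "group G" and "subgroup T G"
    and emb: "\<phi> \<in> mon G (AutoGroup (G\<lparr>carrier := T\<rparr>))"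
    and inn: "\<And>t. t \<in> T \<Longrightarrow> \<phi> t = conj_map G T t"
    and x: "x \<in> carrier G"
  shows "\<phi> x = conj_map G T x"
proof -
  interpret G: group G by fact
  interpret T: subgroup T G by fact
  let ?A = "AutoGroup (G\<lparr>carrier := T\<rparr>)"
  have aut: "\<phi> y \<in> auto (G\<lparr>carrier := T\<rparr>)" if "y \<in> carrier G" for y
    using emb that by (auto simp: mon_def hom_def AutoGroup_def)
  have bij: "\<phi> y \<in> Bij T" if "y \<in> carrier G" for y
    using aut[OF that] by (simp add: auto_def)
  have ext: "\<phi> y \<in> extensional T" and bb: "bij_betw (\<phi> y) T T" if "y \<in> carrier G" for y
    using bij[OF that] by (auto simp: Bij_def)
  have clo: "\<phi> y t \<in> T" if "y \<in> carrier G" "t \<in> T" for y t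
    using bb[OF that(1)] that(2) by (auto simp: bij_betw_def)
  have mul: "\<phi> (y \<otimes>\<^bsub>G\<^esub> z) = compose T (\<phi> y) (\<phi> z)" if "y \<in> carrier G" "z \<in> carrier G" for y z
    using emb that bij by (auto simp: mon_def hom_def AutoGroup_def BijGroup_def)
  have hm: "\<phi> y (s \<otimes>\<^bsub>G\<^esub> t) = \<phi> y s \<otimes>\<^bsub>G\<^esub> \<phi> y t" if "y \<in> carrier G" "s \<in> T" "t \<in> T" for y s t
    using aut[OF that(1)] that by (auto simp: auto_def hom_def)
  have key: "x \<otimes>\<^bsub>G\<^esub> t = \<phi> x t \<otimes>\<^bsub>G\<^esub> x" if t: "t \<in> T" for t
  proof -
    have tG: "t \<in> carrier G" and pT: "\<phi> x t \<in> T" and pG: "\<phi> x t \<in> carrier G"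
      using t clo[OF x t] by auto
    have "\<phi> (x \<otimes>\<^bsub>G\<^esub> t) s = \<phi> (\<phi> x t \<otimes>\<^bsub>G\<^esub> x) s" for s
    proof (cases "s \<in> T")
      case s: True
      have ti: "inv\<^bsub>G\<^esub> t \<in> T" using t by simp
      have "\<phi> x (t \<otimes>\<^bsub>G\<^esub> s \<otimes>\<^bsub>G\<^esub> inv\<^bsub>G\<^esub> t) \<otimes>\<^bsub>G\<^esub> \<phi> x t
          = \<phi> x (t \<otimes>\<^bsub>G\<^esub> s \<otimes>\<^bsub>G\<^esub> inv\<^bsub>G\<^esub> t \<otimes>\<^bsub>G\<^esub> t)"
        using hm[OF x, of "t \<otimes>\<^bsub>G\<^esub> s \<otimes>\<^bsub>G\<^esub> inv\<^bsub>G\<^esub> t" t] s t ti by simp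
      also have "t \<otimes>\<^bsub>G\<^esub> s \<otimes>\<^bsub>G\<^esub> inv\<^bsub>G\<^esub> t \<otimes>\<^bsub>G\<^esub> t = t \<otimes>\<^bsub>G\<^esub> s"
        using s t by (simp add: G.m_assoc)
      also have "\<phi> x (t \<otimes>\<^bsub>G\<^esub> s) = \<phi> x t \<otimes>\<^bsub>G\<^esub> \<phi> x s"
        using hm[OF x t s] .
      finally have "\<phi> x (t \<otimes>\<^bsub>G\<^esub> s \<otimes>\<^bsub>G\<^esub> inv\<^bsub>G\<^esub> t) = \<phi> x t \<otimes>\<^bsub>G\<^esub> \<phi> x s \<otimes>\<^bsub>G\<^esub> inv\<^bsub>G\<^esub> (\<phi> x t)"
        using clo[OF x] s t ti G.inv_solve_right by simp
      then show ?thesis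
        using mul[OF x tG] mul[OF pG x] inn[OF t] inn[OF pT] s t clo[OF x s]
        by (simp add: compose_def conj_map_def)
    next
      case False
      then show ?thesis
        using ext[of "x \<otimes>\<^bsub>G\<^esub> t"] ext[of "\<phi> x t \<otimes>\<^bsub>G\<^esub> x"] x tG pG
        by (simp add: extensional_def)
    qed
    then have "\<phi> (x \<otimes>\<^bsub>G\<^esub> t) = \<phi> (\<phi> x t \<otimes>\<^bsub>G\<^esub> x)" ..
    moreover have "inj_on \<phi> (carrier G)" using emb by (simp add: mon_def)
    ultimately show ?thesis using x tG pG by (auto dest: inj_onD)
  qed
  show ?thesis
  proof
    fix t
    show "\<phi> x t = conj_map G T x t"
    proof (cases "t \<in> T")
      case True
      then have "x \<otimes>\<^bsub>G\<^esub> t \<otimes>\<^bsub>G\<^esub> inv\<^bsub>G\<^esub> x = \<phi> x t"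
        using key[OF True] clo[OF x True] x by (simp add: G.m_assoc)
      then show ?thesis using True by (simp add: conj_map_def)
    next
      case False
      then show ?thesis using ext[OF x] by (simp add: conj_map_def extensional_def)
    qed
  qed
qed

section \<open>Permutation groups\<close>

definition transitive_on :: "('a \<Rightarrow> 'a) set \<Rightarrow> 'a set \<Rightarrow> bool" where
  "transitive_on G \<Omega> \<longleftrightarrow> (\<forall>x\<in>\<Omega>. \<forall>y\<in>\<Omega>. \<exists>p\<in>G. p x = y)"

definition block :: "('a \<Rightarrow> 'a) set \<Rightarrow> 'a set \<Rightarrow> 'a set \<Rightarrow> bool" where
  "block G \<Omega> B \<longleftrightarrow>
     B \<subseteq> \<Omega> \<and> B \<noteq> {} \<and> (\<forall>p\<in>G. p ` B = B \<or> p ` B \<inter> B = {})"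

definition primitive_on :: "('a \<Rightarrow> 'a) set \<Rightarrow> 'a set \<Rightarrow> bool" where
  "primitive_on G \<Omega> \<longleftrightarrow>
     transitive_on G \<Omega> \<and> (\<forall>B. block G \<Omega> B \<longrightarrow> is_singleton B \<or> B = \<Omega>)"

section \<open>Graphs\<close>

record 'v sgraph =
  vertices :: "'v set"
  edges :: "'v set set"

definition simple_graph :: "'v sgraph \<Rightarrow> bool" where
  "simple_graph \<Gamma> \<longleftrightarrow>
     finite (vertices \<Gamma>) \<and> (\<forall>e\<in>edges \<Gamma>. e \<subseteq> vertices \<Gamma> \<and> card e = 2)"

definition regular_graph :: "'v sgraph \<Rightarrow> bool" where
  "regular_graph \<Gamma> \<longleftrightarrow> (\<exists>k. \<forall>v\<in>vertices \<Gamma>. card {e \<in> edges \<Gamma>. v \<in> e} = k)"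

definition graph_auto :: "'v sgraph \<Rightarrow> ('v \<Rightarrow> 'v) set" where
  "graph_auto \<Gamma> =
     {f \<in> Bij (vertices \<Gamma>).
        \<forall>u\<in>vertices \<Gamma>. \<forall>v\<in>vertices \<Gamma>. {f u, f v} \<in> edges \<Gamma> \<longleftrightarrow> {u, v} \<in> edges \<Gamma>}"

definition GraphAutoGroup :: "'v sgraph \<Rightarrow> ('v \<Rightarrow> 'v) monoid" where
  "GraphAutoGroup \<Gamma> = BijGroup (vertices \<Gamma>)\<lparr>carrier := graph_auto \<Gamma>\<rparr>"

definition vertex_transitive :: "'v sgraph \<Rightarrow> bool" where
  "vertex_transitive \<Gamma> \<longleftrightarrow> (\<forall>u\<in>vertices \<Gamma>. \<forall>v\<in>vertices \<Gamma>. \<exists>f\<in>graph_auto \<Gamma>. f u = v)"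

definition edge_transitive :: "'v sgraph \<Rightarrow> bool" where
  "edge_transitive \<Gamma> \<longleftrightarrow> (\<forall>e\<in>edges \<Gamma>. \<forall>e'\<in>edges \<Gamma>. \<exists>f\<in>graph_auto \<Gamma>. f ` e = e')"

definition semisymmetric :: "'v sgraph \<Rightarrow> bool" where
  "semisymmetric \<Gamma> \<longleftrightarrow>
     simple_graph \<Gamma> \<and> regular_graph \<Gamma> \<and> edge_transitive \<Gamma> \<and> \<not> vertex_transitive \<Gamma>"

definition double_coset ::
    "('a, 'b) monoid_scheme \<Rightarrow> 'a set \<Rightarrow> 'a \<Rightarrow> 'a set \<Rightarrow> 'a set" where
  "double_coset G R x L = (R #>\<^bsub>G\<^esub> x) <#>\<^bsub>G\<^esub> L"

definition bicoset_graph ::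
    "('a, 'b) monoid_scheme \<Rightarrow> 'a set \<Rightarrow> 'a set \<Rightarrow> 'a set \<Rightarrow> ('a set + 'a set) sgraph" where
  "bicoset_graph G L R D =
     \<lparr>vertices = Inl ` (rcosets\<^bsub>G\<^esub> L) \<union> Inr ` (rcosets\<^bsub>G\<^esub> R),
      edges = {{Inl (L #>\<^bsub>G\<^esub> x), Inr (R #>\<^bsub>G\<^esub> (d \<otimes>\<^bsub>G\<^esub> x))} | x d. x \<in> carrier G \<and> d \<in> D}\<rparr>"

end

theory Submission
  imports Defs "HOL.Binomial_Plus"
begin

text \<open>Write \<open>\<Omega> = {1..n}\<close> and \<open>\<delta> = g\<^sup>-\<^sup>1 \<omega>\<close>. A right coset \<open>Hx\<close> is determined by the point \<open>x\<^sup>-\<^sup>1 \<omega>\<close>,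
so the bi-coset graph is the bipartite graph on two copies of \<open>\<Omega>\<close> in which \<open>\<alpha>\<close> in the first
copy is joined to \<open>\<beta>\<close> in the second when \<open>(\<alpha>, \<beta>)\<close> lies in the orbital \<open>O = {(x \<omega>, x \<delta>) | x \<in> G}\<close>.
The inequality of the two double cosets says that \<open>O\<close> is not self-paired.

The group \<open>Aut(T)\<close> acts on this graph. Since \<open>Aut(T) = GK\<close> and \<open>G \<inter> K = H\<close> (because \<open>H\<close> is
maximal in \<open>G\<close> and \<open>G \<inter> K = G\<close> would give \<open>K = Aut(T)\<close>), the cosets of \<open>K\<close> correspond to
the points of \<open>\<Omega>\<close>, and the action of \<open>G\<close> on \<open>\<Omega>\<close> extends to \<open>Aut(T)\<close>
(\<open>extend_permutation_group\<close>). This action is faithful because \<open>K\<close> is core-free. Its image \<open>A\<close>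
preserves \<open>O\<close>, since \<open>K \<inter> K\<^sup>g\<close> fixes both \<open>\<omega>\<close> and \<open>\<delta>\<close> and \<open>Aut(T) = G(K \<inter> K\<^sup>g)\<close>.

There are no further automorphisms. The graph is connected, because its components would
otherwise induce a block system of the primitive group \<open>G\<close>; so each automorphism preserves
or exchanges the two copies of \<open>\<Omega>\<close>.

For those that preserve the copies, let \<open>Y\<close> be the overgroup of \<open>G\<close> that they induce on the first
copy. If \<open>Y\<close> contained the alternating group, all \<open>k\<close>-subsets of \<open>\<Omega>\<close> would be neighbourhoods,
where \<open>k\<close> is the valency; but there are at most \<open>n\<close> neighbourhoods, while \<open>2 \<le> k \<le> n/2\<close>
(\<open>in_neighbourhoods_not_all_subsets\<close>). Hence \<open>Y\<close> has socle \<open>T\<close>, so \<open>Y\<close> normalizes \<open>T\<close> and meets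
its centralizer trivially, and as \<open>A\<close> already induces every automorphism of \<open>T\<close> this gives
\<open>Y = A\<close>. Distinct vertices have distinct neighbourhoods, so the action on the second copy is
determined by the first and is the same permutation (\<open>preserving_iff\<close>).

An automorphism exchanging the copies is a pair \<open>(p, q)\<close> of permutations of \<open>\<Omega>\<close>. Conjugating the
diagonal action of \<open>A\<close> by it gives \<open>qaq\<^sup>-\<^sup>1 = pap\<^sup>-\<^sup>1 \<in> A\<close> for all \<open>a \<in> A\<close>. Thus \<open>p\<close> normalizes
\<open>A\<close>, and \<open>A\<close> is self-normalizing in the symmetric group
(\<open>self_normalizing_if_all_automorphisms_inner\<close>), so \<open>p \<in> A\<close>; moreover \<open>p\<^sup>-\<^sup>1q\<close> centralizes \<open>A\<close>,
so \<open>q = p\<close>. Then \<open>O\<close> would be self-paired, a contradiction (\<open>no_reversing\<close>). So the full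
automorphism group is \<open>A \<cong> Aut(T)\<close>; it is transitive on edges, as \<open>G\<close> is, and not on vertices.\<close>

section \<open>Simple subgroups with trivial centralizer\<close>

lemma (in group) inv_mult_cancel_left [simp]:
  assumes "x \<in> carrier G" "y \<in> carrier G"
  shows "inv x \<otimes> (x \<otimes> y) = y" and "x \<otimes> (inv x \<otimes> y) = y"
  using assms by (simp_all add: m_assoc[symmetric])

lemma (in group) commutes_with_inverse:
  assumes "a \<in> carrier G" "t \<in> carrier G" "a \<otimes> t = t \<otimes> a"
  shows "inv a \<otimes> t = t \<otimes> inv a"
proof -
  have "inv a \<otimes> t = inv a \<otimes> (t \<otimes> a) \<otimes> inv a" using assms(1,2) by (simp add: m_assoc)
  also have "\<dots> = inv a \<otimes> (a \<otimes> t) \<otimes> inv a" by (simp only: assms(3))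
  also have "\<dots> = t \<otimes> inv a" using assms(1,2) by simp
  finally show ?thesis .
qed

lemma (in group) commutator_trivial:
  assumes "c \<in> carrier G" "t \<in> carrier G" "c \<otimes> t \<otimes> inv c \<otimes> inv t = \<one>"
  shows "c \<otimes> t = t \<otimes> c"
proof -
  have "c \<otimes> t = c \<otimes> t \<otimes> inv c \<otimes> inv t \<otimes> t \<otimes> c"
    using assms(1,2) by (simp add: m_assoc)
  then show ?thesis using assms by simp
qed

lemma (in group) centralizer_subgroup:
  assumes "T \<subseteq> carrier G"
  shows "subgroup {c\<in>carrier G. \<forall>t\<in>T. c \<otimes> t = t \<otimes> c} G" (is "subgroup ?C G")
proof (rule subgroupI)
  fix a b assume ab: "a \<in> ?C" "b \<in> ?C"
  have "a \<otimes> b \<otimes> t = t \<otimes> (a \<otimes> b)" if t: "t \<in> T" for t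
  proof -
    have carr: "a \<in> carrier G" "b \<in> carrier G" "t \<in> carrier G" using ab t assms by auto
    have "a \<otimes> b \<otimes> t = a \<otimes> (b \<otimes> t)" using carr by (simp add: m_assoc)
    also have "\<dots> = a \<otimes> (t \<otimes> b)" using ab t by simp
    also have "\<dots> = a \<otimes> t \<otimes> b" using carr by (simp add: m_assoc)
    also have "\<dots> = t \<otimes> a \<otimes> b" using ab t by simp
    also have "\<dots> = t \<otimes> (a \<otimes> b)" using carr by (simp add: m_assoc)
    finally show ?thesis .
  qed
  then show "a \<otimes> b \<in> ?C" using ab by auto
next
  fix a assume a: "a \<in> ?C"
  have "inv a \<otimes> t = t \<otimes> inv a" if t: "t \<in> T" for t
  proof -
    have "a \<otimes> t = t \<otimes> a" "a \<in> carrier G" "t \<in> carrier G" using a t assms by auto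
    then show ?thesis by (rule commutes_with_inverse[rotated 2])
  qed
  then show "inv a \<in> ?C" using a by auto
next
  have "\<one> \<in> ?C" using assms by auto
  then show "?C \<noteq> {}" by blast
qed auto

lemma (in group) centralizer_normal:
  assumes "T \<lhd> G"
  shows "{c\<in>carrier G. \<forall>t\<in>T. c \<otimes> t = t \<otimes> c} \<lhd> G" (is "?C \<lhd> G")
proof -
  interpret T: normal T G by fact
  have "x \<otimes> c \<otimes> inv x \<in> ?C" if x: "x \<in> carrier G" and c: "c \<in> ?C" for x c
  proof -
    have "(x \<otimes> c \<otimes> inv x) \<otimes> t = t \<otimes> (x \<otimes> c \<otimes> inv x)" if t: "t \<in> T" for t
    proof -
      have cG: "c \<in> carrier G" using c by simp
      define s where "s = inv x \<otimes> t \<otimes> x"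
      have s: "s \<in> T" using x t by (simp add: s_def T.inv_op_closed1)
      have xs: "t \<otimes> x = x \<otimes> s" using x t by (simp add: s_def m_assoc[symmetric])
      have sx: "inv x \<otimes> t = s \<otimes> inv x" using x t by (simp add: s_def m_assoc)
      have "(x \<otimes> c \<otimes> inv x) \<otimes> t = x \<otimes> (c \<otimes> s) \<otimes> inv x"
        using x cG t sx T.mem_carrier[OF s] by (simp add: m_assoc)
      also have "\<dots> = x \<otimes> (s \<otimes> c) \<otimes> inv x" using c s by simp
      also have "\<dots> = t \<otimes> (x \<otimes> c \<otimes> inv x)"
        using x cG t T.mem_carrier[OF s] xs by (simp add: m_assoc[symmetric])
      finally show ?thesis .
    qed
    then show ?thesis using x c by simp
  qed
  then show ?thesis
    using centralizer_subgroup[OF T.subset] by (simp add: normal_inv_iff)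
qed

text \<open>The centre is a normal subgroup, and it is the whole group only if the group is abelian.\<close>

lemma (in simple_group) center_trivial:
  assumes nonab: "\<not> comm_group G"
    and z: "z \<in> carrier G" "\<forall>t\<in>carrier G. z \<otimes> t = t \<otimes> z"
  shows "z = \<one>"
proof -
  let ?Z = "{z\<in>carrier G. \<forall>t\<in>carrier G. z \<otimes> t = t \<otimes> z}"
  have "?Z \<lhd> G" by (rule centralizer_normal[OF normal_self])
  moreover have "?Z \<noteq> carrier G"
  proof
    assume "?Z = carrier G"
    then have "comm_group G" by (intro group_comm_groupI) auto
    then show False using nonab by simp
  qed
  ultimately have "?Z = {\<one>}" using no_real_normal_subgroup by blast
  then show ?thesis using z by auto
qed

lemma (in group) exists_minimal_normal:
  assumes fin: "finite (carrier G)" and N: "N \<lhd> G" "N \<noteq> {\<one>}"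
  obtains M where "minimal_normal M G" "M \<subseteq> N"
proof -
  have fN: "finite M" if "M \<lhd> G" for M
    using fin that finite_subset normal_imp_subgroup subgroup.subset by metis
  let ?P = "\<lambda>M. M \<lhd> G \<and> M \<subseteq> N \<and> M \<noteq> {\<one>}"
  define M where "M = arg_min card ?P"
  have M: "?P M" unfolding M_def by (rule arg_min_natI[of ?P N]) (use N in auto)
  have least: "card M \<le> card L" if "?P L" for L
    unfolding M_def by (rule arg_min_nat_le[of ?P L]) (use that in auto)
  have "minimal_normal M G"
    unfolding minimal_normal_def
  proof (intro conjI allI impI)
    fix L assume L: "L \<lhd> G \<and> L \<subseteq> M"
    show "L = {\<one>} \<or> L = M"
    proof (rule disjCI)
      assume "L \<noteq> M"
      then have "card L < card M" using L M fN psubset_card_mono by blast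
      then show "L = {\<one>}" using least[of L] L M by force
    qed
  qed (use M in auto)
  then show thesis using M that by blast
qed

lemma (in group) socle_normal: "socle G \<lhd> G"
  unfolding socle_def
proof (rule normal_generateI)
  show "\<Union> {N. minimal_normal N G} \<subseteq> carrier G"
    by (auto simp: minimal_normal_def dest!: normal_imp_subgroup subgroup.subset)
next
  fix h x assume "h \<in> \<Union> {N. minimal_normal N G}" "x \<in> carrier G"
  then show "x \<otimes> h \<otimes> inv x \<in> \<Union> {N. minimal_normal N G}"
    by (auto simp: minimal_normal_def normal_inv_iff)
qed

text \<open>The centralizer of the socle is normal. If it were nontrivial it would contain a minimal
normal subgroup; that subgroup lies in the socle too, hence in the centre of the socle.\<close>

lemma (in group) centralizer_of_simple_socle:
  assumes fin: "finite (carrier G)"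
    and simple: "simple_group (G\<lparr>carrier := socle G\<rparr>)"
    and nonab: "\<not> comm_group (G\<lparr>carrier := socle G\<rparr>)"
    and c: "c \<in> carrier G" "\<forall>t\<in>socle G. c \<otimes> t = t \<otimes> c"
  shows "c = \<one>"
proof -
  interpret T: normal "socle G" G by (rule socle_normal)
  interpret TG: simple_group "G\<lparr>carrier := socle G\<rparr>" by fact
  let ?C = "{c\<in>carrier G. \<forall>t\<in>socle G. c \<otimes> t = t \<otimes> c}"
  have C: "?C \<lhd> G" by (rule centralizer_normal[OF socle_normal])
  have "?C = {\<one>}"
  proof (rule ccontr)
    assume "?C \<noteq> {\<one>}"
    then obtain M where M: "minimal_normal M G" "M \<subseteq> ?C"
      using exists_minimal_normal[OF fin C] by blast
    then have MT: "M \<subseteq> socle G" unfolding socle_def by (auto intro: generate.incl)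
    have "z = \<one>" if "z \<in> M" for z
      using TG.center_trivial[OF nonab, of z] that MT M(2) by auto
    then have "M \<subseteq> {\<one>}" by blast
    moreover have "\<one> \<in> M" "M \<noteq> {\<one>}"
      using M(1) by (auto simp: minimal_normal_def dest!: normal_imp_subgroup subgroup.one_closed)
    ultimately show False by blast
  qed
  then show ?thesis using c by auto
qed

text \<open>If \<open>N\<close> meets the simple group \<open>T\<close> trivially, all commutators of elements of \<open>N\<close> and \<open>T\<close> are
trivial, as they lie in both groups; then \<open>N\<close> centralizes \<open>T\<close>.\<close>

lemma (in group) nontrivial_normal_contains_simple_normal:
  assumes T: "T \<lhd> G" and simple: "simple_group (G\<lparr>carrier := T\<rparr>)"
    and centralizer: "\<And>c. c \<in> carrier G \<Longrightarrow> \<forall>t\<in>T. c \<otimes> t = t \<otimes> c \<Longrightarrow> c = \<one>"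
    and N: "N \<lhd> G" "N \<noteq> {\<one>}"
  shows "T \<subseteq> N"
proof -
  interpret T: normal T G by fact
  interpret N: normal N G by fact
  interpret TG: simple_group "G\<lparr>carrier := T\<rparr>" by fact
  have "T \<inter> N \<lhd> G\<lparr>carrier := T\<rparr>"
    using normal_Int_subgroup[OF T.subgroup_axioms N(1)] by (simp add: Int_commute)
  then consider "T \<inter> N = T" | "T \<inter> N = {\<one>}"
    using TG.no_real_normal_subgroup by fastforce
  then show ?thesis
  proof cases
    case 2
    have "c = \<one>" if c: "c \<in> N" for c
    proof (rule centralizer)
      show "\<forall>t\<in>T. c \<otimes> t = t \<otimes> c"
      proof
        fix t assume t: "t \<in> T"
        have [simp]: "t \<in> carrier G" "c \<in> carrier G" using c t by auto
        have "c \<otimes> t \<otimes> inv c \<otimes> inv t \<in> T"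
          using t T.inv_op_closed2[of c t] by simp
        moreover have "c \<otimes> (t \<otimes> inv c \<otimes> inv t) \<in> N"
          using c N.inv_op_closed2[of t "inv c"] by auto
        moreover have "c \<otimes> t \<otimes> inv c \<otimes> inv t = c \<otimes> (t \<otimes> inv c \<otimes> inv t)"
          by (simp add: m_assoc)
        ultimately have "c \<otimes> t \<otimes> inv c \<otimes> inv t = \<one>" using 2 by auto
        then show "c \<otimes> t = t \<otimes> c" by (rule commutator_trivial[rotated 2]) simp_all
      qed
    qed (use c in simp)
    then have "N = {\<one>}" using N.one_closed by blast
    then show ?thesis using N(2) by simp
  qed auto
qed

lemma (in group) equal_conjugation_centralizes:
  assumes "a \<in> carrier G" "x \<in> carrier G" "t \<in> carrier G"
    and eq: "a \<otimes> t \<otimes> inv a = x \<otimes> t \<otimes> inv x"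
  shows "inv a \<otimes> x \<otimes> t = t \<otimes> (inv a \<otimes> x)"
proof -
  note [simp] = assms(1-3)
  have "inv a \<otimes> x \<otimes> t = inv a \<otimes> (x \<otimes> t \<otimes> inv x) \<otimes> x" by (simp add: m_assoc)
  also have "\<dots> = inv a \<otimes> (a \<otimes> t \<otimes> inv a) \<otimes> x" by (simp only: eq)
  also have "\<dots> = t \<otimes> (inv a \<otimes> x)" by (simp add: m_assoc)
  finally show ?thesis .
qed

text \<open>Let \<open>x\<close> normalize \<open>A\<close>. The conjugate of \<open>T\<close> by \<open>x\<close> is again a nontrivial normal subgroup of \<open>A\<close>, so
it contains \<open>T\<close>, and equals it by cardinality. By assumption some \<open>a \<in> A\<close> induces the same
automorphism of \<open>T\<close> as \<open>x\<close>, so \<open>c = a\<^sup>-\<^sup>1x\<close> centralizes \<open>T\<close> and normalizes \<open>A\<close>. Then \<open>b\<close> and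
\<open>cbc\<^sup>-\<^sup>1\<close> act in the same way on \<open>T\<close> for each \<open>b \<in> A\<close>; since \<open>A\<close> acts faithfully on \<open>T\<close>, the
element \<open>c\<close> centralizes \<open>A\<close> and is trivial.\<close>

lemma (in group) self_normalizing_if_all_automorphisms_inner:
  assumes fin: "finite (carrier G)"
    and A: "subgroup A G" and T: "T \<lhd> G\<lparr>carrier := A\<rparr>"
    and simple: "simple_group (G\<lparr>carrier := T\<rparr>)"
    and centralizer_T: "\<And>c. c \<in> A \<Longrightarrow> \<forall>t\<in>T. c \<otimes> t = t \<otimes> c \<Longrightarrow> c = \<one>"
    and induced: "\<And>x. x \<in> carrier G \<Longrightarrow> \<forall>t\<in>T. x \<otimes> t \<otimes> inv x \<in> T \<Longrightarrow>
      \<exists>a\<in>A. \<forall>t\<in>T. a \<otimes> t \<otimes> inv a = x \<otimes> t \<otimes> inv x"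
    and centralizer_A: "\<And>c. c \<in> carrier G \<Longrightarrow> \<forall>a\<in>A. c \<otimes> a = a \<otimes> c \<Longrightarrow> c = \<one>"
    and x: "x \<in> carrier G" "\<forall>a\<in>A. x \<otimes> a \<otimes> inv x \<in> A"
  shows "x \<in> A"
proof -
  interpret A: subgroup A G by fact
  interpret AG: group "G\<lparr>carrier := A\<rparr>" by (rule subgroup_imp_group[OF A])
  interpret TA: normal T "G\<lparr>carrier := A\<rparr>" by fact
  have sT: "subgroup T G" using incl_subgroup[OF A TA.subgroup_axioms] .
  interpret T: subgroup T G by fact
  have T_A: "T \<subseteq> A" using TA.subset by simp
  have normT: "a \<otimes> t \<otimes> inv a \<in> T" if "a \<in> A" "t \<in> T" for a t
    using TA.inv_op_closed2[of a t] that by (simp add: m_inv_consistent[OF A])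
  note [simp] = x(1)
  define f where "f = (\<lambda>a. x \<otimes> a \<otimes> inv x)"
  have f_carr[simp]: "f a \<in> carrier G" if "a \<in> carrier G" for a using that by (simp add: f_def)
  have f_mult: "f (a \<otimes> b) = f a \<otimes> f b" if "a \<in> carrier G" "b \<in> carrier G" for a b
    using that by (simp add: f_def m_assoc)
  have f_inv: "f (inv a) = inv (f a)" if "a \<in> carrier G" for a
    using that by (simp add: f_def inv_mult_group m_assoc)
  have inj: "inj_on f (carrier G)" by (auto simp: f_def inj_on_def)
  have fA: "f ` A = A"
  proof (rule card_subset_eq)
    show "f ` A \<subseteq> A" using x by (auto simp: f_def)
    show "card (f ` A) = card A" using inj A.subset by (metis card_image inj_on_subset)
    show "finite A" using fin A.subset by (rule rev_finite_subset)
  qed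
  have "f ` T \<lhd> G\<lparr>carrier := A\<rparr>"
  proof (rule AG.normal_invI)
    have "f \<in> hom G G" by (auto simp: hom_def f_mult)
    then interpret f: group_hom G G f by unfold_locales
    have "subgroup (f ` T) G" by (rule f.subgroup_img_is_subgroup[OF sT])
    then show "subgroup (f ` T) (G\<lparr>carrier := A\<rparr>)"
      using subgroup_incl A fA T_A by blast
  next
    fix a u assume a: "a \<in> carrier (G\<lparr>carrier := A\<rparr>)" and u: "u \<in> f ` T"
    from a fA obtain b where b: "b \<in> A" "a = f b" by auto
    from u obtain t where t: "t \<in> T" "u = f t" by auto
    have "a \<otimes> u \<otimes> inv a = f (b \<otimes> t \<otimes> inv b)"
      using b t A.subset T.subset by (simp add: f_mult f_inv subset_iff)
    then show "a \<otimes>\<^bsub>G\<lparr>carrier := A\<rparr>\<^esub> u \<otimes>\<^bsub>G\<lparr>carrier := A\<rparr>\<^esub> inv\<^bsub>G\<lparr>carrier := A\<rparr>\<^esub> a \<in> f ` T"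
      using a normT b(1) t(1) by (simp add: m_inv_consistent[OF A])
  qed
  moreover have "f ` T \<noteq> {\<one>}"
  proof
    assume "f ` T = {\<one>}"
    then have "card (f ` T) = 1" by simp
    then have "card T = 1" using card_image[OF inj_on_subset[OF inj T.subset]] by simp
    then show False using simple_group.order_gt_one[OF simple] by (simp add: order_def)
  qed
  ultimately have "T \<subseteq> f ` T"
    using AG.nontrivial_normal_contains_simple_normal[OF T, of "f ` T"] simple centralizer_T by auto
  moreover have "card (f ` T) = card T" using inj T.subset by (metis card_image inj_on_subset)
  moreover have "finite (f ` T)" using fin T.subset finite_subset by blast
  ultimately have "f ` T = T" using card_subset_eq[of "f ` T" T] by simp
  then have "\<forall>t\<in>T. x \<otimes> t \<otimes> inv x \<in> T" by (auto simp: f_def)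
  from induced[OF x(1) this] obtain a
    where a: "a \<in> A" "\<And>t. t \<in> T \<Longrightarrow> a \<otimes> t \<otimes> inv a = x \<otimes> t \<otimes> inv x" by blast
  have [simp]: "a \<in> carrier G" using a(1) by simp
  define c where "c = inv a \<otimes> x"
  have [simp]: "c \<in> carrier G" by (simp add: c_def)
  have cT: "c \<otimes> t = t \<otimes> c" if t: "t \<in> T" for t
    using equal_conjugation_centralizes[of a x t] a(2)[OF t] t by (simp add: c_def)
  have "c \<otimes> b = b \<otimes> c" if b: "b \<in> A" for b
  proof -
    have [simp]: "b \<in> carrier G" using b by simp
    define d where "d = c \<otimes> b \<otimes> inv c"
    have [simp]: "d \<in> carrier G" by (simp add: d_def)
    have dA: "d \<in> A"
    proof -
      have "d = inv a \<otimes> (x \<otimes> b \<otimes> inv x) \<otimes> a"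
        by (simp add: d_def c_def inv_mult_group m_assoc)
      then show ?thesis using x(2) a(1) b by auto
    qed
    have "inv b \<otimes> d = \<one>"
    proof (rule centralizer_T)
      show "inv b \<otimes> d \<in> A" using b dA by simp
      show "\<forall>t\<in>T. inv b \<otimes> d \<otimes> t = t \<otimes> (inv b \<otimes> d)"
      proof
        fix t assume t: "t \<in> T"
        define s where "s = b \<otimes> t \<otimes> inv b"
        have s: "s \<in> T" using normT b t by (simp add: s_def)
        have [simp]: "s \<in> carrier G" "t \<in> carrier G" using s t by auto
        have bt: "b \<otimes> t = s \<otimes> b" by (simp add: s_def m_assoc)
        have ict: "inv c \<otimes> t = t \<otimes> inv c"
          using cT[OF t] by (intro commutes_with_inverse) auto
        have "d \<otimes> t = c \<otimes> (b \<otimes> t) \<otimes> inv c" by (simp add: d_def m_assoc ict)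
        also have "\<dots> = (c \<otimes> s) \<otimes> b \<otimes> inv c" by (simp add: bt m_assoc)
        also have "\<dots> = s \<otimes> d" by (simp add: cT[OF s] d_def m_assoc)
        finally have "inv b \<otimes> (d \<otimes> t) = inv b \<otimes> (s \<otimes> d)" by simp
        also have "\<dots> = t \<otimes> (inv b \<otimes> d)" by (simp add: s_def m_assoc)
        finally show "inv b \<otimes> d \<otimes> t = t \<otimes> (inv b \<otimes> d)" by (simp add: m_assoc)
      qed
    qed
    then have "b \<otimes> (inv b \<otimes> d) \<otimes> c = b \<otimes> c" by simp
    then show ?thesis by (simp add: d_def m_assoc)
  qed
  then have "c = \<one>" by (intro centralizer_A) auto
  then have "a \<otimes> (inv a \<otimes> x) = a" by (simp add: c_def)
  then have "x = a" by simp
  then show ?thesis using a(1) by simp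
qed

section \<open>Extending a permutation group\<close>

text \<open>Points matter only through membership in \<open>{1..n}\<close>, which is therefore kept as an atomic
condition.\<close>

declare atLeastAtMost_iff [simp del]

locale permutation_group =
  fixes n :: nat and G :: "(nat \<Rightarrow> nat) set"
  assumes subgroup_sym: "subgroup G (sym_group n)"
begin

lemma permutes: "x \<in> G \<Longrightarrow> x permutes {1..n}"
  using subgroup.subset[OF subgroup_sym] by (auto simp: sym_group_carrier)

lemma id_mem: "id \<in> G"
  using subgroup.one_closed[OF subgroup_sym] by (simp add: sym_group_one)

lemma comp_mem: "x \<in> G \<Longrightarrow> y \<in> G \<Longrightarrow> x \<circ> y \<in> G"
  using subgroup.m_closed[OF subgroup_sym] by (simp add: sym_group_mult)

lemma inv_mem: "x \<in> G \<Longrightarrow> inv' x \<in> G"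
  using subgroup.m_inv_closed[OF subgroup_sym] permutes
  by (metis sym_group_carrier sym_group_inv_equality)

lemma in_range: "x \<in> G \<Longrightarrow> x \<alpha> \<in> {1..n} \<longleftrightarrow> \<alpha> \<in> {1..n}"
  by (rule permutes_in_image[OF permutes])

lemma inv_apply: "x \<in> G \<Longrightarrow> inv' x (x \<alpha>) = \<alpha>" "x \<in> G \<Longrightarrow> x (inv' x \<alpha>) = \<alpha>"
  using permutes_inverses[OF permutes] by auto

lemma inv_eq_iff: "x \<in> G \<Longrightarrow> inv' x \<alpha> = \<beta> \<longleftrightarrow> \<alpha> = x \<beta>"
  using inv_apply[of x] by auto

lemma apply_eq_iff: "x \<in> G \<Longrightarrow> x \<alpha> = x \<beta> \<longleftrightarrow> \<alpha> = \<beta>"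
  using inv_apply(1)[of x] by metis

end

lemma permutation_groupI:
  assumes "id \<in> G" "\<And>x. x \<in> G \<Longrightarrow> x permutes {1..n}"
    and "\<And>x y. x \<in> G \<Longrightarrow> y \<in> G \<Longrightarrow> x \<circ> y \<in> G" "\<And>x. x \<in> G \<Longrightarrow> inv' x \<in> G"
  shows "permutation_group n G"
proof (rule permutation_group.intro)
  interpret S: group "sym_group n" by (rule sym_group_is_group)
  show "subgroup G (sym_group n)"
    by (rule S.subgroupI) (use assms in \<open>auto simp: sym_group_carrier sym_group_mult\<close>)
qed

text \<open>The factorization identifies the left cosets of \<open>K\<close> in \<open>A\<close> with the points: \<open>\<iota> z \<otimes> k\<close>, for \<open>z \<in> G\<close>
and \<open>k \<in> K\<close>, lies in the coset of the point \<open>z \<omega>\<close>. The extension \<open>\<rho>\<close> is left multiplication on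
these cosets.\<close>

lemma extend_permutation_group:
  assumes A: "group A" and K: "subgroup K A"
    and G: "subgroup G (sym_group n)"
    and hom: "\<iota> \<in> hom (sym_group n\<lparr>carrier := G\<rparr>) A"
    and transitive: "transitive_on G {1..n}" and \<omega>: "\<omega> \<in> {1..n}"
    and stabilizer: "\<And>x. x \<in> G \<Longrightarrow> \<iota> x \<in> K \<longleftrightarrow> x \<omega> = \<omega>"
    and factorization: "carrier A = \<iota> ` G <#>\<^bsub>A\<^esub> K"
  obtains \<rho> where "\<rho> \<in> hom A (sym_group n)" "\<And>x. x \<in> G \<Longrightarrow> \<rho> (\<iota> x) = x"
    "\<And>a. a \<in> carrier A \<Longrightarrow> \<rho> a \<omega> = \<omega> \<longleftrightarrow> a \<in> K"
proof -
  interpret A: group A by fact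
  interpret K: subgroup K A by fact
  interpret permutation_group n G by (rule permutation_group.intro) (rule G)
  interpret PG: group "sym_group n\<lparr>carrier := G\<rparr>"
    by (rule group.subgroup_imp_group[OF sym_group_is_group G])
  interpret \<iota>: group_hom "sym_group n\<lparr>carrier := G\<rparr>" A \<iota>
    by unfold_locales (rule hom)
  let ?\<Omega> = "{1..n}"
  have \<iota>_carr[simp]: "\<iota> x \<in> carrier A" if "x \<in> G" for x using \<iota>.hom_closed that by simp
  have \<iota>_comp: "\<iota> (x \<circ> y) = \<iota> x \<otimes>\<^bsub>A\<^esub> \<iota> y" if "x \<in> G" "y \<in> G" for x y
    using \<iota>.hom_mult[of x y] that by (simp add: sym_group_mult)
  have \<iota>_inv: "\<iota> (inv' x) \<otimes>\<^bsub>A\<^esub> \<iota> x = \<one>\<^bsub>A\<^esub>" if "x \<in> G" for x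
    using \<iota>_comp[OF inv_mem[OF that] that] \<iota>.hom_one permutes_inv_o(2)[OF permutes[OF that]]
    by (simp add: sym_group_one)
  have \<iota>_inv: "\<iota> (inv' x) = inv\<^bsub>A\<^esub> \<iota> x" if "x \<in> G" for x
    using \<iota>_inv[OF that] that by (simp add: A.inv_equality inv_mem)
  have split: "\<exists>z\<in>G. \<exists>k\<in>K. a = \<iota> z \<otimes>\<^bsub>A\<^esub> k" if "a \<in> carrier A" for a
    using that factorization by (auto simp: set_mult_def)
  have coset_eq: "z \<omega> = y \<omega> \<longleftrightarrow> inv\<^bsub>A\<^esub> \<iota> y \<otimes>\<^bsub>A\<^esub> \<iota> z \<in> K" if "z \<in> G" "y \<in> G" for z y
    using stabilizer[of "inv' y \<circ> z"] that
    by (simp add: \<iota>_comp \<iota>_inv inv_mem comp_mem inv_eq_iff)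
  \<comment> \<open>the point that corresponds to the coset of \<open>a\<close>\<close>
  define pt where "pt a = (THE \<alpha>. \<exists>z\<in>G. \<exists>k\<in>K. a = \<iota> z \<otimes>\<^bsub>A\<^esub> k \<and> \<alpha> = z \<omega>)" for a
  have pt: "pt (\<iota> z \<otimes>\<^bsub>A\<^esub> k) = z \<omega>" if z: "z \<in> G" and k: "k \<in> K" for z k
    unfolding pt_def
  proof (rule the_equality)
    fix \<alpha> assume "\<exists>y\<in>G. \<exists>l\<in>K. \<iota> z \<otimes>\<^bsub>A\<^esub> k = \<iota> y \<otimes>\<^bsub>A\<^esub> l \<and> \<alpha> = y \<omega>"
    then obtain y l where y: "y \<in> G" "l \<in> K" "\<iota> z \<otimes>\<^bsub>A\<^esub> k = \<iota> y \<otimes>\<^bsub>A\<^esub> l" "\<alpha> = y \<omega>" by auto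
    have "inv\<^bsub>A\<^esub> \<iota> y \<otimes>\<^bsub>A\<^esub> \<iota> z = inv\<^bsub>A\<^esub> \<iota> y \<otimes>\<^bsub>A\<^esub> (\<iota> z \<otimes>\<^bsub>A\<^esub> k) \<otimes>\<^bsub>A\<^esub> inv\<^bsub>A\<^esub> k"
      using z k y(1) by (simp add: A.m_assoc)
    also have "\<dots> = l \<otimes>\<^bsub>A\<^esub> inv\<^bsub>A\<^esub> k"
      using y(1,2) k unfolding y(3) by (simp add: A.m_assoc[symmetric])
    finally have "inv\<^bsub>A\<^esub> \<iota> y \<otimes>\<^bsub>A\<^esub> \<iota> z \<in> K" using y(2) k by simp
    then show "\<alpha> = z \<omega>" using coset_eq[OF z y(1)] y(4) by simp
  qed (use that in blast)
  have pt_\<iota>: "pt (\<iota> z) = z \<omega>" if "z \<in> G" for z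
    using pt[OF that K.one_closed] that by simp
  have pt_K: "pt (a \<otimes>\<^bsub>A\<^esub> k) = pt a" if a: "a \<in> carrier A" and k: "k \<in> K" for a k
  proof -
    obtain z l where "z \<in> G" "l \<in> K" "a = \<iota> z \<otimes>\<^bsub>A\<^esub> l" using split[OF a] by blast
    then show ?thesis using k pt[of z l] pt[of z "l \<otimes>\<^bsub>A\<^esub> k"] by (simp add: A.m_assoc)
  qed
  have pt_eq: "inv\<^bsub>A\<^esub> a \<otimes>\<^bsub>A\<^esub> b \<in> K" if a: "a \<in> carrier A" and b: "b \<in> carrier A" and eq: "pt a = pt b" for a b
  proof -
    obtain y l where y: "y \<in> G" "l \<in> K" "a = \<iota> y \<otimes>\<^bsub>A\<^esub> l" using split[OF a] by blast
    obtain z k where z: "z \<in> G" "k \<in> K" "b = \<iota> z \<otimes>\<^bsub>A\<^esub> k" using split[OF b] by blast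
    have "z \<omega> = y \<omega>" using eq y z pt by simp
    then have "inv\<^bsub>A\<^esub> \<iota> y \<otimes>\<^bsub>A\<^esub> \<iota> z \<in> K" using coset_eq y z by blast
    moreover have "inv\<^bsub>A\<^esub> a \<otimes>\<^bsub>A\<^esub> b = inv\<^bsub>A\<^esub> l \<otimes>\<^bsub>A\<^esub> (inv\<^bsub>A\<^esub> \<iota> y \<otimes>\<^bsub>A\<^esub> \<iota> z) \<otimes>\<^bsub>A\<^esub> k"
      using y z by (simp add: A.inv_mult_group A.m_assoc)
    ultimately show ?thesis using y z by simp
  qed
  have pt_cong: "pt (c \<otimes>\<^bsub>A\<^esub> a) = pt (c \<otimes>\<^bsub>A\<^esub> b)"
    if a: "a \<in> carrier A" and b: "b \<in> carrier A" and c: "c \<in> carrier A" and eq: "pt a = pt b" for a b c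
  proof -
    have "c \<otimes>\<^bsub>A\<^esub> b = c \<otimes>\<^bsub>A\<^esub> a \<otimes>\<^bsub>A\<^esub> (inv\<^bsub>A\<^esub> a \<otimes>\<^bsub>A\<^esub> b)"
      using a b c by (simp add: A.m_assoc)
    then show ?thesis using pt_K[OF _ pt_eq[OF a b eq]] a c by simp
  qed
  have pt_range: "pt a \<in> ?\<Omega>" if "a \<in> carrier A" for a
    using split[OF that] pt \<omega> in_range by fastforce
  have pt_surj: "\<exists>a\<in>carrier A. pt a = \<alpha>" if "\<alpha> \<in> ?\<Omega>" for \<alpha>
    using transitive that \<omega> unfolding transitive_on_def by (metis \<iota>_carr pt_\<iota>)
  define rep where "rep \<alpha> = (SOME a. a \<in> carrier A \<and> pt a = \<alpha>)" for \<alpha>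
  have rep: "rep \<alpha> \<in> carrier A" "pt (rep \<alpha>) = \<alpha>" if "\<alpha> \<in> ?\<Omega>" for \<alpha>
    using someI_ex[of "\<lambda>a. a \<in> carrier A \<and> pt a = \<alpha>"] pt_surj[OF that] by (auto simp: rep_def)
  define \<rho> where "\<rho> a = (\<lambda>\<alpha>. if \<alpha> \<in> ?\<Omega> then pt (a \<otimes>\<^bsub>A\<^esub> rep \<alpha>) else \<alpha>)" for a
  have \<rho>_pt: "\<rho> a (pt b) = pt (a \<otimes>\<^bsub>A\<^esub> b)" if "a \<in> carrier A" "b \<in> carrier A" for a b
    using pt_cong[OF rep(1) that(2,1) rep(2)] pt_range[OF that(2)] by (simp add: \<rho>_def)
  have \<rho>_mult: "\<rho> (a \<otimes>\<^bsub>A\<^esub> b) = \<rho> a \<circ> \<rho> b" if ab: "a \<in> carrier A" "b \<in> carrier A" for a b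
  proof
    fix \<alpha> show "\<rho> (a \<otimes>\<^bsub>A\<^esub> b) \<alpha> = (\<rho> a \<circ> \<rho> b) \<alpha>"
    proof (cases "\<alpha> \<in> ?\<Omega>")
      case True
      then obtain c where "c \<in> carrier A" "\<alpha> = pt c" using pt_surj by blast
      then show ?thesis using ab by (simp add: \<rho>_pt A.m_assoc)
    next
      case False
      then show ?thesis by (simp add: \<rho>_def)
    qed
  qed
  have \<rho>_one: "\<rho> \<one>\<^bsub>A\<^esub> = id" using rep by (auto simp: \<rho>_def)
  have \<rho>_permutes: "\<rho> a permutes ?\<Omega>" if a: "a \<in> carrier A" for a
  proof -
    have "bij (\<rho> a)"
      by (rule o_bij[of "\<rho> (inv\<^bsub>A\<^esub> a)"]) (use a \<rho>_mult[symmetric] \<rho>_one in simp_all)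
    moreover have "\<rho> a \<alpha> = \<alpha>" if "\<alpha> \<notin> ?\<Omega>" for \<alpha> using that by (auto simp: \<rho>_def)
    ultimately show ?thesis unfolding permutes_def bij_iff by blast
  qed
  show thesis
  proof
    show "\<rho> \<in> hom A (sym_group n)"
      using \<rho>_permutes \<rho>_mult by (simp add: hom_def sym_group_carrier sym_group_mult)
  next
    fix x assume x: "x \<in> G"
    show "\<rho> (\<iota> x) = x"
    proof
      fix \<alpha> show "\<rho> (\<iota> x) \<alpha> = x \<alpha>"
      proof (cases "\<alpha> \<in> ?\<Omega>")
        case True
        then obtain z where z: "z \<in> G" "z \<omega> = \<alpha>"
          using transitive \<omega> by (auto simp: transitive_on_def)
        then have "\<rho> (\<iota> x) \<alpha> = pt (\<iota> x \<otimes>\<^bsub>A\<^esub> \<iota> z)" using \<rho>_pt[of "\<iota> x" "\<iota> z"] x pt_\<iota> by simp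
        also have "\<dots> = x \<alpha>" using \<iota>_comp[OF x z(1)] pt_\<iota>[OF comp_mem[OF x z(1)]] z(2) by simp
        finally show ?thesis .
      next
        case False
        then show ?thesis using permutes[OF x] by (simp add: \<rho>_def permutes_not_in)
      qed
    qed
  next
    fix a assume a: "a \<in> carrier A"
    have one: "pt \<one>\<^bsub>A\<^esub> = \<omega>" using pt_\<iota>[OF id_mem] \<iota>.hom_one by (simp add: sym_group_one)
    then have "\<rho> a \<omega> = pt a" using \<rho>_pt[OF a A.one_closed] a by simp
    moreover have "pt a = \<omega> \<longleftrightarrow> a \<in> K"
      using pt_eq[OF A.one_closed a] pt_K[OF A.one_closed, of a] a one by auto
    ultimately show "\<rho> a \<omega> = \<omega> \<longleftrightarrow> a \<in> K" by simp
  qed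
qed

section \<open>Nonabelian primitive groups\<close>

text \<open>A primitive group of prime order, where point stabilizers are trivial and fix every point, has to
be excluded; noncommutativity does this.\<close>

locale primitive_group = permutation_group +
  fixes \<omega> :: nat
  assumes primitive: "primitive_on G {1..n}"
    and \<omega>: "\<omega> \<in> {1..n}"
    and nonabelian: "\<exists>s\<in>G. \<exists>t\<in>G. s \<circ> t \<noteq> t \<circ> s"
begin

definition stab :: "(nat \<Rightarrow> nat) set" where "stab = {x\<in>G. x \<omega> = \<omega>}"

lemma transitiveE:
  assumes "\<alpha> \<in> {1..n}" "\<beta> \<in> {1..n}"
  obtains x where "x \<in> G" "x \<alpha> = \<beta>"
  using primitive assms unfolding primitive_on_def transitive_on_def by blast

lemma block_trivial: "block G {1..n} B \<Longrightarrow> is_singleton B \<or> B = {1..n}"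
  using primitive unfolding primitive_on_def by blast

text \<open>The classes of an invariant equivalence relation are blocks.\<close>

lemma equivalence_trivial:
  assumes sym: "\<And>\<alpha> \<beta>. E \<alpha> \<beta> \<Longrightarrow> E \<beta> \<alpha>"
    and trans: "\<And>\<alpha> \<beta> \<gamma>. E \<alpha> \<beta> \<Longrightarrow> E \<beta> \<gamma> \<Longrightarrow> E \<alpha> \<gamma>"
    and refl: "\<And>\<alpha>. \<alpha> \<in> {1..n} \<Longrightarrow> E \<alpha> \<alpha>"
    and inv: "\<And>x \<alpha> \<beta>. x \<in> G \<Longrightarrow> \<alpha> \<in> {1..n} \<Longrightarrow> \<beta> \<in> {1..n} \<Longrightarrow> E \<alpha> \<beta> \<Longrightarrow> E (x \<alpha>) (x \<beta>)"
    and pair: "\<alpha>\<^sub>0 \<in> {1..n}" "\<beta>\<^sub>0 \<in> {1..n}" "\<alpha>\<^sub>0 \<noteq> \<beta>\<^sub>0" "E \<alpha>\<^sub>0 \<beta>\<^sub>0"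
    and "\<alpha> \<in> {1..n}" "\<beta> \<in> {1..n}"
  shows "E \<alpha> \<beta>"
proof -
  define B where "B = {\<beta>\<in>{1..n}. E \<alpha>\<^sub>0 \<beta>}"
  have "block G {1..n} B"
    unfolding block_def
  proof (intro conjI ballI)
    show "B \<subseteq> {1..n}" "B \<noteq> {}" using pair by (auto simp: B_def)
    fix p assume p: "p \<in> G"
    have sub: "x ` B \<subseteq> B" if x: "x \<in> G" and meet: "x ` B \<inter> B \<noteq> {}" for x
    proof
      fix \<gamma> assume "\<gamma> \<in> x ` B"
      then obtain \<gamma>' where g: "\<gamma>' \<in> B" "\<gamma> = x \<gamma>'" by auto
      obtain \<beta> where b: "\<beta> \<in> B" "x \<beta> \<in> B" using meet by auto
      have "E \<beta> \<gamma>'" using b g sym trans unfolding B_def by blast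
      then have "E (x \<beta>) \<gamma>" using inv[OF x, of \<beta> \<gamma>'] b g by (auto simp: B_def)
      then have "E \<alpha>\<^sub>0 \<gamma>" using b trans by (auto simp: B_def)
      then show "\<gamma> \<in> B" using g in_range[OF x] by (simp add: B_def)
    qed
    show "p ` B = B \<or> p ` B \<inter> B = {}"
    proof (cases "p ` B \<inter> B = {}")
      case False
      have "inv' p ` B \<inter> B \<noteq> {}"
      proof -
        obtain \<beta> where "\<beta> \<in> B" "p \<beta> \<in> B" using False by auto
        then have "\<beta> \<in> inv' p ` B \<inter> B" using inv_apply(1)[OF p, of \<beta>] by force
        then show ?thesis by blast
      qed
      then have "inv' p ` B \<subseteq> B" by (rule sub[OF inv_mem[OF p]])
      then have "p ` inv' p ` B \<subseteq> p ` B" by (rule image_mono)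
      then have "B \<subseteq> p ` B" by (simp add: image_image inv_apply p)
      then show ?thesis using sub[OF p False] by blast
    qed simp
  qed
  moreover have "\<alpha>\<^sub>0 \<in> B" "\<beta>\<^sub>0 \<in> B" using pair refl by (auto simp: B_def)
  then have "\<not> is_singleton B" using pair(3) by (auto simp: is_singleton_def)
  ultimately have "B = {1..n}" using block_trivial by blast
  then have "\<alpha> \<in> B" "\<beta> \<in> B" using \<open>\<alpha> \<in> {1..n}\<close> \<open>\<beta> \<in> {1..n}\<close> by simp_all
  then have "E \<alpha>\<^sub>0 \<alpha>" "E \<alpha>\<^sub>0 \<beta>" by (simp_all add: B_def)
  then show ?thesis by (rule trans[OF sym])
qed

text \<open>A group \<open>P\<close> above the stabilizer gives the invariant equivalence relation that identifies \<open>y \<omega>\<close>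
and \<open>z \<omega>\<close> when \<open>y\<close> and \<open>z\<close> lie in the same left coset of \<open>P\<close>.\<close>

lemma stab_maximal:
  assumes P: "P \<subseteq> G" "\<And>x y. x \<in> P \<Longrightarrow> y \<in> P \<Longrightarrow> x \<circ> y \<in> P" "\<And>x. x \<in> P \<Longrightarrow> inv' x \<in> P"
    and sub: "stab \<subseteq> P" and proper: "x\<^sub>0 \<in> P" "x\<^sub>0 \<notin> stab"
  shows "P = G"
proof -
  have id: "id \<in> P" using sub id_mem by (auto simp: stab_def)
  define E where "E \<alpha> \<beta> = (\<exists>y\<in>G. \<exists>z\<in>G. y \<omega> = \<alpha> \<and> z \<omega> = \<beta> \<and> inv' y \<circ> z \<in> P)" for \<alpha> \<beta>
  \<comment> \<open>membership in \<open>P\<close> depends only on the points, because \<open>P\<close> contains the stabilizer\<close>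
  have rep: "inv' y \<circ> z \<in> P" if "E (y \<omega>) (z \<omega>)" "y \<in> G" "z \<in> G" for y z
  proof -
    obtain y' z' where y': "y' \<in> G" "z' \<in> G" "y' \<omega> = y \<omega>" "z' \<omega> = z \<omega>" "inv' y' \<circ> z' \<in> P"
      using \<open>E (y \<omega>) (z \<omega>)\<close> by (auto simp: E_def)
    have "inv' y \<circ> y' \<in> P" "inv' z' \<circ> z \<in> P"
      using sub y' that by (auto simp: stab_def subset_iff comp_mem inv_mem inv_eq_iff)
    then have "(inv' y \<circ> y') \<circ> ((inv' y' \<circ> z') \<circ> (inv' z' \<circ> z)) \<in> P"
      using P(2) y'(5) by blast
    moreover have "(inv' y \<circ> y') \<circ> ((inv' y' \<circ> z') \<circ> (inv' z' \<circ> z)) = inv' y \<circ> z"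
      by (auto simp: inv_apply y')
    ultimately show ?thesis by simp
  qed
  have inv_comp: "inv' (inv' y \<circ> z) = inv' z \<circ> y" if "y \<in> G" "z \<in> G" for y z
    using that by (intro inv_equality) (auto simp: inv_apply)
  have full: "E \<alpha> \<beta>" if "\<alpha> \<in> {1..n}" "\<beta> \<in> {1..n}" for \<alpha> \<beta>
  proof (rule equivalence_trivial)
    show "E \<beta> \<alpha>" if E: "E \<alpha> \<beta>" for \<alpha> \<beta>
    proof -
      obtain y z where "y \<in> G" "z \<in> G" "y \<omega> = \<alpha>" "z \<omega> = \<beta>" "inv' y \<circ> z \<in> P"
        using E by (auto simp: E_def)
      then show ?thesis unfolding E_def using P(3)[of "inv' y \<circ> z"] inv_comp[of y z] by auto
    qed
    show "E \<alpha> \<gamma>" if E: "E \<alpha> \<beta>" "E \<beta> \<gamma>" for \<alpha> \<beta> \<gamma>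
    proof -
      obtain y z where y: "y \<in> G" "z \<in> G" "y \<omega> = \<alpha>" "z \<omega> = \<beta>" "inv' y \<circ> z \<in> P"
        using E by (auto simp: E_def)
      obtain w where w: "w \<in> G" "w \<omega> = \<gamma>" using E by (auto simp: E_def)
      have "(inv' y \<circ> z) \<circ> (inv' z \<circ> w) \<in> P"
        using rep[of z w] E y w P(2) by blast
      moreover have "(inv' y \<circ> z) \<circ> (inv' z \<circ> w) = inv' y \<circ> w" by (auto simp: inv_apply y)
      ultimately show ?thesis using y w by (auto simp: E_def)
    qed
    show "E \<alpha> \<alpha>" if \<alpha>: "\<alpha> \<in> {1..n}" for \<alpha>
    proof -
      obtain y where y: "y \<in> G" "y \<omega> = \<alpha>" using transitiveE[OF \<omega> \<alpha>] .
      then have "inv' y \<circ> y \<in> P" using id permutes_inv_o(2)[OF permutes[OF y(1)]] by simp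
      then show ?thesis unfolding E_def using y by blast
    qed
    show "E (x \<alpha>) (x \<beta>)" if x: "x \<in> G" and "E \<alpha> \<beta>" for x \<alpha> \<beta>
    proof -
      obtain y z where y: "y \<in> G" "z \<in> G" "y \<omega> = \<alpha>" "z \<omega> = \<beta>" "inv' y \<circ> z \<in> P"
        using \<open>E \<alpha> \<beta>\<close> by (auto simp: E_def)
      have "inv' (x \<circ> y) \<circ> (x \<circ> z) = inv' y \<circ> z"
      proof -
        have "inv' (x \<circ> y) = inv' y \<circ> inv' x"
          using x y by (intro inv_equality) (auto simp: inv_apply)
        then show ?thesis using x by (auto simp: inv_apply)
      qed
      then show ?thesis unfolding E_def using x y
        by (intro bexI[of _ "x \<circ> y"] bexI[of _ "x \<circ> z"]) (auto simp: comp_mem)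
    qed
    show "\<omega> \<in> {1..n}" "x\<^sub>0 \<omega> \<in> {1..n}" "\<omega> \<noteq> x\<^sub>0 \<omega>"
      using \<omega> in_range P(1) proper by (auto simp: stab_def)
    show "E \<omega> (x\<^sub>0 \<omega>)" unfolding E_def using id_mem P(1) proper(1)
      by (intro bexI[of _ id] bexI[of _ x\<^sub>0]) auto
  qed (use that in auto)
  have "x \<in> P" if x: "x \<in> G" for x
    using rep[of id x] full[OF \<omega>, of "x \<omega>"] in_range[OF x] \<omega> x id_mem by auto
  then show ?thesis using P(1) by blast
qed

text \<open>The elements that move \<open>\<omega>\<close> to a fixed point of its stabilizer \<open>H\<close> form the normalizer of \<open>H\<close>.
If this is larger than \<open>H\<close>, it is \<open>G\<close> by maximality, so \<open>H\<close> fixes all points and is trivial.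
Then \<open>G\<close> has no proper nontrivial subgroups, contradicting the existence of the proper centralizer
of a noncentral element.\<close>

lemma stab_fixes_only_base_point:
  assumes \<delta>: "\<delta> \<in> {1..n}" "\<And>h. h \<in> stab \<Longrightarrow> h \<delta> = \<delta>"
  shows "\<delta> = \<omega>"
proof (rule ccontr)
  assume ne: "\<delta> \<noteq> \<omega>"
  obtain x where x: "x \<in> G" "x \<omega> = \<delta>" using transitiveE[OF \<omega> \<delta>(1)] .
  define N where "N = {y\<in>G. \<forall>h\<in>stab. h (y \<omega>) = y \<omega>}"
  have "G \<subseteq> {p. p permutes {1..n}}" using permutes by blast
  then have fin: "finite N"
    using finite_permutations[of "{1..n}"] by (auto simp: N_def intro: rev_finite_subset)
  have N_comp: "y \<circ> z \<in> N" if y: "y \<in> N" and z: "z \<in> N" for y z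
  proof -
    have yz: "y \<in> G" "z \<in> G" using y z by (auto simp: N_def)
    have "h (y (z \<omega>)) = y (z \<omega>)" if h: "h \<in> stab" for h
    proof -
      have hG: "h \<in> G" using h by (simp add: stab_def)
      have "h (y \<omega>) = y \<omega>" using y h by (simp add: N_def)
      then have "inv' y \<circ> (h \<circ> y) \<in> stab"
        using yz hG by (simp add: stab_def comp_mem inv_mem inv_apply)
      then have "inv' y (h (y (z \<omega>))) = z \<omega>" using z by (auto simp: N_def)
      then show ?thesis using inv_eq_iff[OF yz(1)] by blast
    qed
    then show ?thesis using yz by (simp add: N_def comp_mem)
  qed
  have N_inv: "inv' y \<in> N" if y: "y \<in> N" for y
  proof -
    have yG: "y \<in> G" using y by (simp add: N_def)
    \<comment> \<open>a finite set closed under composition is closed under inverses: left translation by \<open>y\<close>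
      is a bijection of \<open>N\<close>\<close>
    have "inj_on ((\<circ>) y) N"
    proof (rule inj_onI)
      fix u v assume "y \<circ> u = y \<circ> v"
      then show "u = v" using apply_eq_iff[OF yG] by (simp add: fun_eq_iff)
    qed
    moreover have "(\<circ>) y ` N \<subseteq> N" using N_comp y by blast
    ultimately have "(\<circ>) y ` N = N" using fin by (simp add: endo_inj_surj)
    moreover have "id \<in> N" by (auto simp: N_def id_mem stab_def)
    ultimately obtain z where z: "z \<in> N" "id = y \<circ> z" by blast
    have "inv' y = z" using z(2) apply_eq_iff[OF yG] inv_apply(2)[OF yG]
      by (simp add: fun_eq_iff) metis
    then show ?thesis using z(1) by simp
  qed
  have "N = G"
  proof (rule stab_maximal)
    show "x \<in> N" using x \<delta> by (simp add: N_def)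
    show "x \<notin> stab" using x ne by (simp add: stab_def)
    show "stab \<subseteq> N" by (auto simp: N_def stab_def)
    show "N \<subseteq> G" by (auto simp: N_def)
  qed (use N_comp N_inv in auto)
  have trivial: "h = id" if h: "h \<in> stab" for h
  proof
    fix \<alpha>
    show "h \<alpha> = id \<alpha>"
    proof (cases "\<alpha> \<in> {1..n}")
      case True
      then obtain y where "y \<in> G" "y \<omega> = \<alpha>" using transitiveE[OF \<omega>] by blast
      then show ?thesis using \<open>N = G\<close> h by (auto simp: N_def)
    next
      case False
      then show ?thesis using permutes[of h] h by (simp add: stab_def permutes_not_in)
    qed
  qed
  obtain s t where st: "s \<in> G" "t \<in> G" "s \<circ> t \<noteq> t \<circ> s" using nonabelian by blast
  define Z where "Z = {y\<in>G. y \<circ> s = s \<circ> y}"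
  have "Z = G"
  proof (rule stab_maximal)
    show "Z \<subseteq> G" by (auto simp: Z_def)
    show "y \<circ> z \<in> Z" if "y \<in> Z" "z \<in> Z" for y z
    proof -
      have "y (z (s \<alpha>)) = s (y (z \<alpha>))" for \<alpha> using that by (simp add: Z_def fun_eq_iff)
      then have "y \<circ> z \<circ> s = s \<circ> (y \<circ> z)" by (simp add: fun_eq_iff)
      then show ?thesis using that by (simp add: Z_def comp_mem)
    qed
    show "inv' y \<in> Z" if y: "y \<in> Z" for y
    proof -
      have yG: "y \<in> G" using y by (simp add: Z_def)
      have "inv' y (s \<alpha>) = s (inv' y \<alpha>)" for \<alpha>
      proof -
        have "y (s (inv' y \<alpha>)) = s (y (inv' y \<alpha>))" using y by (simp add: Z_def fun_eq_iff)
        then show ?thesis using yG by (simp add: inv_eq_iff inv_apply)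
      qed
      then show ?thesis using yG by (simp add: Z_def inv_mem fun_eq_iff)
    qed
    show "stab \<subseteq> Z"
    proof
      fix h assume "h \<in> stab"
      then show "h \<in> Z" using trivial[of h] id_mem by (simp add: Z_def)
    qed
    show "s \<in> Z" using st by (simp add: Z_def)
    show "s \<notin> stab" using trivial[of s] st(3) by auto
  qed
  then have "t \<in> Z" using st by simp
  then show False using st(3) by (simp add: Z_def)
qed

text \<open>A permutation commuting with \<open>G\<close> maps \<open>\<omega>\<close> to a fixed point of its stabilizer, that is, to \<open>\<omega>\<close>
itself; by transitivity it fixes all points.\<close>

lemma commuting_permutation_trivial:
  assumes c: "c permutes {1..n}" "\<And>x. x \<in> G \<Longrightarrow> c \<circ> x = x \<circ> c"
  shows "c = id"
proof
  have comm: "c (x \<alpha>) = x (c \<alpha>)" if "x \<in> G" for x \<alpha> using c(2)[OF that] by (simp add: fun_eq_iff)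
  have "c \<omega> = \<omega>"
  proof (rule stab_fixes_only_base_point)
    show "c \<omega> \<in> {1..n}" using \<omega> permutes_in_image[OF c(1)] by blast
    show "h (c \<omega>) = c \<omega>" if "h \<in> stab" for h using that comm[of h \<omega>] by (simp add: stab_def)
  qed
  fix \<alpha> show "c \<alpha> = id \<alpha>"
  proof (cases "\<alpha> \<in> {1..n}")
    case True
    then obtain x where "x \<in> G" "x \<omega> = \<alpha>" using transitiveE[OF \<omega>] by blast
    then show ?thesis using comm[of x \<omega>] \<open>c \<omega> = \<omega>\<close> by simp
  next
    case False
    then show ?thesis using c(1) by (simp add: permutes_not_in)
  qed
qed

end

section \<open>Orbitals that are not self-paired\<close>

text \<open>A permutation with the required effect can be made even by composing it with a transposition
of two points of \<open>B\<close>.\<close>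

lemma alt_group_homogeneous:
  assumes "B \<subseteq> {1..n}" "B' \<subseteq> {1..n}" "card B = card B'" "2 \<le> card B"
  obtains p where "p \<in> carrier (alt_group n)" "p ` B = B'"
proof -
  have fin: "finite B" "finite B'" using assms finite_subset by blast+
  obtain f where f: "bij_betw f B B'"
    using finite_same_card_bij[OF fin assms(3)] by blast
  have "card ({1..n} - B) = card ({1..n} - B')"
    using assms fin by (simp add: card_Diff_subset)
  then obtain h where h: "bij_betw h ({1..n} - B) ({1..n} - B')"
    using finite_same_card_bij[of "{1..n} - B" "{1..n} - B'"] by auto
  define p where "p x = (if x \<in> B then f x else if x \<in> {1..n} then h x else x)" for x
  have "bij_betw p (B \<union> ({1..n} - B)) (B' \<union> ({1..n} - B'))"
  proof (rule bij_betw_combine)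
    show "bij_betw p B B'" using f by (subst bij_betw_cong[of B p f]) (auto simp: p_def)
    show "bij_betw p ({1..n} - B) ({1..n} - B')"
      using h by (subst bij_betw_cong[of "{1..n} - B" p h]) (auto simp: p_def)
  qed auto
  then have "bij_betw p {1..n} {1..n}" using assms by (simp add: Un_absorb1)
  then have p: "p permutes {1..n}"
    by (rule bij_imp_permutes) (use assms in \<open>auto simp: p_def\<close>)
  have pB: "p ` B = B'" using f by (auto simp: p_def bij_betw_def)
  show thesis
  proof (cases "evenperm p")
    case True
    then show thesis using that p pB by (simp add: alt_group_carrier)
  next
    case False
    have "\<not> card B \<le> Suc 0" using assms by simp
    then obtain a b where ab: "a \<in> B" "b \<in> B" "a \<noteq> b"
      using card_le_Suc0_iff_eq[OF fin(1)] by auto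
    let ?t = "transpose a b"
    have t: "?t permutes {1..n}" using ab assms by (intro permutes_swap_id) auto
    have "evenperm (p \<circ> ?t)"
      using False ab p t by (subst evenperm_comp) (auto simp: evenperm_swap permutation_permutes)
    moreover have "?t ` B = B" using ab by (auto simp: transpose_def image_iff)
    then have "(p \<circ> ?t) ` B = B'" using pB by (metis image_comp)
    ultimately show thesis using that[of "p \<circ> ?t"] permutes_compose[OF t p]
      by (simp add: alt_group_carrier)
  qed
qed

lemma less_binomial:
  assumes "2 \<le> k" "2 * k \<le> n"
  shows "n < n choose k"
proof -
  have "4 \<le> n" using assms by simp
  then have "n * 3 \<le> n * (n - 1)" by (intro mult_le_mono2) simp
  then have "n < n * (n - 1) div 2" using \<open>4 \<le> n\<close> by linarith
  also have "\<dots> = n choose 2" by (simp add: choose_two)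
  also have "\<dots> \<le> n choose k" using assms by (rule binomial_mono)
  finally show ?thesis .
qed

text \<open>The assumption \<open>unpaired\<close> says that no element of \<open>G\<close> maps the pair \<open>(\<omega>, \<delta>)\<close> to \<open>(\<delta>, \<omega>)\<close>.
The orbital is read as a digraph on the points: \<open>orb `` {\<alpha>}\<close> and \<open>orb\<inverse> `` {\<alpha>}\<close> are the
out- and in-neighbourhoods of \<open>\<alpha>\<close>.\<close>

locale unpaired_orbital = primitive_group +
  fixes \<delta> :: nat
  assumes \<delta>: "\<delta> \<in> {1..n}"
    and unpaired: "x \<in> G \<Longrightarrow> x \<omega> = \<delta> \<Longrightarrow> x \<delta> \<noteq> \<omega>"
begin

definition orb :: "(nat \<times> nat) set" where "orb = {(x \<omega>, x \<delta>) |x. x \<in> G}"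

lemma orb_range: "(\<alpha>, \<beta>) \<in> orb \<Longrightarrow> \<alpha> \<in> {1..n}" "(\<alpha>, \<beta>) \<in> orb \<Longrightarrow> \<beta> \<in> {1..n}"
  using \<omega> \<delta> in_range by (auto simp: orb_def)

lemma orb_base: "(\<omega>, \<delta>) \<in> orb"
  unfolding orb_def using id_mem by (auto intro!: exI[of _ id])

lemma orb_image: "x \<in> G \<Longrightarrow> (\<alpha>, \<beta>) \<in> orb \<Longrightarrow> (x \<alpha>, x \<beta>) \<in> orb"
proof -
  assume x: "x \<in> G" and "(\<alpha>, \<beta>) \<in> orb"
  then obtain y where "y \<in> G" "\<alpha> = y \<omega>" "\<beta> = y \<delta>" by (auto simp: orb_def)
  then show ?thesis unfolding orb_def using x by (auto simp: comp_mem intro!: exI[of _ "x \<circ> y"])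
qed

lemma orb_image_iff: "x \<in> G \<Longrightarrow> (x \<alpha>, x \<beta>) \<in> orb \<longleftrightarrow> (\<alpha>, \<beta>) \<in> orb"
  using orb_image[of x \<alpha> \<beta>] orb_image[OF inv_mem, of x "x \<alpha>" "x \<beta>"] by (auto simp: inv_apply)

lemma orb_asym: "(\<alpha>, \<beta>) \<in> orb \<Longrightarrow> (\<beta>, \<alpha>) \<notin> orb"
proof
  assume "(\<alpha>, \<beta>) \<in> orb" "(\<beta>, \<alpha>) \<in> orb"
  then obtain x y where xy: "x \<in> G" "y \<in> G" "\<alpha> = x \<omega>" "\<beta> = x \<delta>" "\<beta> = y \<omega>" "\<alpha> = y \<delta>"
    by (auto simp: orb_def)
  have "inv' x \<circ> y \<in> G" "(inv' x \<circ> y) \<omega> = \<delta>" "(inv' x \<circ> y) \<delta> = \<omega>"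
    using xy by (simp_all add: comp_mem inv_mem inv_eq_iff)
  then show False using unpaired by blast
qed

definition valency :: nat where "valency = card (orb `` {\<omega>})"

lemma finite_orb: "finite orb"
  using orb_range by (intro finite_subset[of orb "{1..n} \<times> {1..n}"]) auto

lemma out_degree: 
  assumes "\<alpha> \<in> {1..n}" shows "card (orb `` {\<alpha>}) = valency"
proof -
  obtain x where x: "x \<in> G" "x \<omega> = \<alpha>" using transitiveE[OF \<omega> assms] .
  have "bij_betw x (orb `` {\<omega>}) (orb `` {\<alpha>})"
    by (rule bij_betw_byWitness[where f' = "inv' x"])
      (use x in \<open>auto simp: inv_apply orb_image_iff orb_image[of x \<omega>] dest: orb_image[OF inv_mem[OF x(1)]]\<close>)
  then show ?thesis by (simp add: valency_def bij_betw_same_card)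
qed

text \<open>All in-degrees agree by transitivity, so counting the arcs by their sources and by their targets
shows that they equal the out-degrees.\<close>

lemma in_degree: 
  assumes "\<beta> \<in> {1..n}" shows "card (orb\<inverse> `` {\<beta>}) = valency"
proof -
  have const: "card (orb\<inverse> `` {\<beta>}) = card (orb\<inverse> `` {\<omega>})" if \<beta>: "\<beta> \<in> {1..n}" for \<beta>
  proof -
    obtain x where x: "x \<in> G" "x \<omega> = \<beta>" using transitiveE[OF \<omega> \<beta>] .
    have "bij_betw x (orb\<inverse> `` {\<omega>}) (orb\<inverse> `` {\<beta>})"
      by (rule bij_betw_byWitness[where f' = "inv' x"])
        (use x in \<open>auto simp: inv_apply orb_image_iff orb_image[of x _ \<omega>] dest: orb_image[OF inv_mem[OF x(1)]]\<close>)
    then show ?thesis by (simp add: bij_betw_same_card)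
  qed
  have "orb = Sigma {1..n} (\<lambda>\<alpha>. orb `` {\<alpha>})" using orb_range by auto
  then have "card orb = (\<Sum>\<alpha>\<in>{1..n}. card (orb `` {\<alpha>}))"
    using finite_orb by (metis card_SigmaI finite_Image finite_atLeastAtMost)
  also have "\<dots> = n * valency" using out_degree by simp
  finally have out: "card orb = n * valency" .
  have "orb\<inverse> = Sigma {1..n} (\<lambda>\<alpha>. orb\<inverse> `` {\<alpha>})" using orb_range by auto
  then have "card (orb\<inverse>) = (\<Sum>\<alpha>\<in>{1..n}. card (orb\<inverse> `` {\<alpha>}))"
    using finite_orb by (metis card_SigmaI finite_Image finite_converse finite_atLeastAtMost)
  also have "\<dots> = n * card (orb\<inverse> `` {\<omega>})" using const by simp
  finally have "n * valency = n * card (orb\<inverse> `` {\<omega>})" using out by (simp add: card_inverse)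
  moreover have "0 < n" using \<omega> by (cases n) auto
  ultimately show ?thesis using const[OF assms] by auto
qed

text \<open>The stabilizer of \<open>\<omega>\<close> would fix a unique out-neighbour of \<open>\<omega>\<close>, which gives the lower bound.
The upper bound holds because the in- and out-neighbourhoods of \<open>\<omega>\<close> are disjoint.\<close>

lemma valency_bounds: "2 \<le> valency" "2 * valency \<le> n"
proof -
  have fin: "finite (orb `` {\<omega>})" "finite (orb\<inverse> `` {\<omega>})" using finite_orb by (auto intro: finite_Image)
  have "valency \<noteq> 0" using fin(1) orb_base by (auto simp: valency_def)
  moreover have "valency \<noteq> 1"
  proof
    assume "valency = 1"
    then obtain \<gamma> where "orb `` {\<omega>} = {\<gamma>}" by (auto simp: valency_def card_1_singleton_iff)
    moreover have "\<delta> \<in> orb `` {\<omega>}" using orb_base by blast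
    ultimately have single: "orb `` {\<omega>} = {\<delta>}" by simp
    have "\<delta> = \<omega>"
    proof (rule stab_fixes_only_base_point[OF \<delta>])
      fix h assume "h \<in> stab"
      then have "(\<omega>, h \<delta>) \<in> orb" using orb_image[OF _ orb_base, of h] by (auto simp: stab_def)
      then show "h \<delta> = \<delta>" using single by blast
    qed
    then show False using orb_asym orb_base by auto
  qed
  ultimately show "2 \<le> valency" by simp
  have "2 * valency = card (orb `` {\<omega>} \<union> orb\<inverse> `` {\<omega>})"
    using fin orb_asym in_degree[OF \<omega>] by (subst card_Un_disjoint) (auto simp: valency_def)
  also have "\<dots> \<le> card {1..n}" using orb_range by (intro card_mono) auto
  finally show "2 * valency \<le> n" by simp
qed

text \<open>Having the same in-neighbours is an invariant equivalence relation. Were it not equality, all points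
would have the same in-neighbours, so \<open>\<omega>\<close> would be an in-neighbour of itself.\<close>

lemma no_twins:
  assumes "\<beta> \<in> {1..n}" "\<gamma> \<in> {1..n}" "\<And>\<alpha>. \<alpha> \<in> {1..n} \<Longrightarrow> (\<alpha>, \<beta>) \<in> orb \<longleftrightarrow> (\<alpha>, \<gamma>) \<in> orb"
  shows "\<beta> = \<gamma>"
proof (rule ccontr)
  assume ne: "\<beta> \<noteq> \<gamma>"
  let ?E = "\<lambda>\<beta> \<gamma>. \<forall>\<alpha>. (\<alpha>, \<beta>) \<in> orb \<longleftrightarrow> (\<alpha>, \<gamma>) \<in> orb"
  have "?E \<delta> \<omega>"
  proof (rule equivalence_trivial[of ?E \<beta> \<gamma>])
    fix x \<beta> \<gamma> assume x: "x \<in> G" and E: "?E \<beta> \<gamma>"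
    show "?E (x \<beta>) (x \<gamma>)"
    proof
      fix \<alpha>
      show "(\<alpha>, x \<beta>) \<in> orb \<longleftrightarrow> (\<alpha>, x \<gamma>) \<in> orb"
        using E orb_image_iff[OF x, of "inv' x \<alpha>"] by (simp add: inv_apply x)
    qed
  next
    show "?E \<beta> \<gamma>" using assms(3) orb_range by blast
  qed (use assms ne \<omega> \<delta> in auto)
  then show False using orb_base orb_asym by blast
qed

text \<open>Being connected in the bipartite double of the orbital is an invariant equivalence relation, and
it is not equality because in-degrees are at least 2. Connectedness is expressed by induction:
a set that is closed under passing to a point with a common out-neighbour contains all points
as soon as it contains one.\<close>

lemma connected:
  assumes P: "\<And>\<alpha> \<alpha>' \<beta>. (\<alpha>, \<beta>) \<in> orb \<Longrightarrow> (\<alpha>', \<beta>) \<in> orb \<Longrightarrow> \<alpha> \<in> P \<Longrightarrow> \<alpha>' \<in> P"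
    and \<alpha>: "\<alpha> \<in> {1..n}" "\<alpha>' \<in> {1..n}" "\<alpha> \<in> P"
  shows "\<alpha>' \<in> P"
proof -
  define closed where "closed P \<longleftrightarrow> (\<forall>\<alpha> \<alpha>' \<beta>. (\<alpha>, \<beta>) \<in> orb \<longrightarrow> (\<alpha>', \<beta>) \<in> orb \<longrightarrow> \<alpha> \<in> P \<longrightarrow> \<alpha>' \<in> P)" for P
  let ?E = "\<lambda>\<alpha> \<alpha>'. \<forall>P. closed P \<longrightarrow> (\<alpha> \<in> P \<longleftrightarrow> \<alpha>' \<in> P)"
  have "\<not> card (orb\<inverse> `` {\<omega>}) \<le> Suc 0" using in_degree[OF \<omega>] valency_bounds by simp
  then obtain \<alpha>\<^sub>0 \<beta>\<^sub>0 where ab: "(\<alpha>\<^sub>0, \<omega>) \<in> orb" "(\<beta>\<^sub>0, \<omega>) \<in> orb" "\<alpha>\<^sub>0 \<noteq> \<beta>\<^sub>0"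
    using card_le_Suc0_iff_eq[of "orb\<inverse> `` {\<omega>}"] finite_orb by (auto simp: finite_Image)
  have "?E \<alpha> \<alpha>'"
  proof (rule equivalence_trivial[of ?E \<alpha>\<^sub>0 \<beta>\<^sub>0])
    fix x \<alpha> \<alpha>' assume x: "x \<in> G" and E: "?E \<alpha> \<alpha>'"
    show "?E (x \<alpha>) (x \<alpha>')"
    proof (intro allI impI)
      fix P assume "closed P"
      then have "closed (x -` P)"
        unfolding closed_def vimage_def using orb_image[OF x] by blast
      then show "x \<alpha> \<in> P \<longleftrightarrow> x \<alpha>' \<in> P" using E by auto
    qed
  next
    show "?E \<alpha>\<^sub>0 \<beta>\<^sub>0" using ab(1,2) unfolding closed_def by blast
  qed (use \<alpha> ab orb_range in auto)
  moreover have "closed P" unfolding closed_def by (intro allI impI) (rule P)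
  ultimately show ?thesis using \<alpha>(3) by simp
qed

text \<open>If every even permutation of the sources extends to a symmetry of the orbital, then each subset with
\<open>valency\<close> elements is an in-neighbourhood, by homogeneity. But at most \<open>n\<close> subsets are.\<close>

lemma in_neighbourhoods_not_all_subsets:
  assumes lift: "\<And>p. p \<in> carrier (alt_group n) \<Longrightarrow>
    \<exists>q. q permutes {1..n} \<and> (\<forall>\<alpha>\<in>{1..n}. \<forall>\<beta>\<in>{1..n}. (p \<alpha>, q \<beta>) \<in> orb \<longleftrightarrow> (\<alpha>, \<beta>) \<in> orb)"
  shows False
proof -
  let ?N = "\<lambda>\<beta>. orb\<inverse> `` {\<beta>}"
  have sub: "?N \<beta> \<subseteq> {1..n}" for \<beta> using orb_range by auto
  have "{B. B \<subseteq> {1..n} \<and> card B = valency} \<subseteq> ?N ` {1..n}"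
  proof clarify
    fix B assume B: "B \<subseteq> {1..n}" "card B = valency"
    obtain p where p: "p \<in> carrier (alt_group n)" "p ` ?N \<omega> = B"
      by (rule alt_group_homogeneous[of "?N \<omega>" n B])
        (use sub B in_degree[OF \<omega>] valency_bounds in auto)
    obtain q where q: "q permutes {1..n}"
      and pq: "\<And>\<alpha> \<beta>. \<alpha> \<in> {1..n} \<Longrightarrow> \<beta> \<in> {1..n} \<Longrightarrow> (p \<alpha>, q \<beta>) \<in> orb \<longleftrightarrow> (\<alpha>, \<beta>) \<in> orb"
      using lift[OF p(1)] by blast
    have pp: "p permutes {1..n}" using p(1) by (simp add: alt_group_carrier)
    have "B = ?N (q \<omega>)"
    proof
      show "B \<subseteq> ?N (q \<omega>)" using p(2) pq orb_range \<omega> by auto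
      show "?N (q \<omega>) \<subseteq> B"
      proof
        fix \<alpha> assume a: "\<alpha> \<in> ?N (q \<omega>)"
        then have "inv' p \<alpha> \<in> {1..n}"
          using sub permutes_in_image[OF permutes_inv[OF pp]] by blast
        then have "(inv' p \<alpha>, \<omega>) \<in> orb"
          using a pq[of "inv' p \<alpha>" \<omega>] \<omega> permutes_inverses(1)[OF pp] by simp
        then have "p (inv' p \<alpha>) \<in> p ` ?N \<omega>" by blast
        then show "\<alpha> \<in> B" using p(2) permutes_inverses(1)[OF pp] by simp
      qed
    qed
    moreover have "q \<omega> \<in> {1..n}" using permutes_in_image[OF q] \<omega> by blast
    ultimately show "B \<in> ?N ` {1..n}" by blast
  qed
  then have "card {B. B \<subseteq> {1..n} \<and> card B = valency} \<le> card (?N ` {1..n})"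
    by (intro card_mono) auto
  also have "\<dots> \<le> n" using card_image_le[of "{1..n}" ?N] by simp
  finally have "n choose valency \<le> n" using n_subsets[of "{1..n}" valency] by simp
  then show False using less_binomial[OF valency_bounds] by simp
qed

end

section \<open>Symmetries of an unpaired orbital\<close>

text \<open>The group \<open>A\<close> stands for the image of \<open>Aut(T)\<close>: it preserves the orbital, and it induces every
automorphism of \<open>T\<close> that is induced by some permutation.\<close>

locale saturated_orbital = unpaired_orbital +
  fixes T A :: "(nat \<Rightarrow> nat) set"
  assumes simple: "simple_group (sym_group n\<lparr>carrier := T\<rparr>)"
    and nonab: "\<not> comm_group (sym_group n\<lparr>carrier := T\<rparr>)"
    and A: "subgroup A (sym_group n)" and G_sub_A: "G \<subseteq> A"
    and A_preserves: "a \<in> A \<Longrightarrow> (\<alpha>, \<beta>) \<in> orb \<Longrightarrow> (a \<alpha>, a \<beta>) \<in> orb"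
    and A_induces: "p permutes {1..n} \<Longrightarrow> \<forall>t\<in>T. p \<circ> t \<circ> inv' p \<in> T \<Longrightarrow>
      \<exists>a\<in>A. \<forall>t\<in>T. a \<circ> t \<circ> inv' a = p \<circ> t \<circ> inv' p"
    and overgroup_socle: "subgroup Y (sym_group n) \<Longrightarrow> G \<subseteq> Y \<Longrightarrow>
      Y \<noteq> carrier (alt_group n) \<Longrightarrow> Y \<noteq> carrier (sym_group n) \<Longrightarrow>
      socle (sym_group n\<lparr>carrier := Y\<rparr>) = T"
begin

sublocale S: group "sym_group n" by (rule sym_group_is_group)

sublocale A: permutation_group n A by (rule permutation_group.intro) (rule A)

text \<open>A pair \<open>(p, q)\<close> describes a map on two disjoint copies of the point set, with \<open>p\<close> acting on the
sources and \<open>q\<close> on the targets of arcs.\<close>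

definition preserving :: "(nat \<Rightarrow> nat) \<Rightarrow> (nat \<Rightarrow> nat) \<Rightarrow> bool" where
  "preserving p q \<longleftrightarrow> p permutes {1..n} \<and> q permutes {1..n} \<and>
    (\<forall>\<alpha>\<in>{1..n}. \<forall>\<beta>\<in>{1..n}. (p \<alpha>, q \<beta>) \<in> orb \<longleftrightarrow> (\<alpha>, \<beta>) \<in> orb)"

lemma preservingD:
  assumes "preserving p q"
  shows "p permutes {1..n}" "q permutes {1..n}"
    and "\<alpha> \<in> {1..n} \<Longrightarrow> \<beta> \<in> {1..n} \<Longrightarrow> (p \<alpha>, q \<beta>) \<in> orb \<longleftrightarrow> (\<alpha>, \<beta>) \<in> orb"
  using assms by (auto simp: preserving_def)

lemma preserving_comp: "preserving p q \<Longrightarrow> preserving p' q' \<Longrightarrow> preserving (p \<circ> p') (q \<circ> q')"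
  unfolding preserving_def by (auto simp: permutes_compose permutes_in_image)

lemma preserving_inv: 
  assumes "preserving p q" shows "preserving (inv' p) (inv' q)"
  unfolding preserving_def
proof (intro conjI ballI)
  note pq = preservingD[OF assms]
  show inv: "inv' p permutes {1..n}" "inv' q permutes {1..n}" using pq by (simp_all add: permutes_inv)
  fix \<alpha> \<beta> assume "\<alpha> \<in> {1..n}" "\<beta> \<in> {1..n}"
  then show "(inv' p \<alpha>, inv' q \<beta>) \<in> orb \<longleftrightarrow> (\<alpha>, \<beta>) \<in> orb"
    using pq(3)[of "inv' p \<alpha>" "inv' q \<beta>"] permutes_in_image[OF inv(1)] permutes_in_image[OF inv(2)]
    by (simp add: permutes_inverses[OF pq(1)] permutes_inverses[OF pq(2)])
qed

lemma preserving_diagonal: 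
  assumes a: "a \<in> A" shows "preserving a a"
proof -
  have "(\<alpha>, \<beta>) \<in> orb" if "(a \<alpha>, a \<beta>) \<in> orb" for \<alpha> \<beta>
    using A_preserves[OF A.inv_mem[OF a] that] by (simp add: A.inv_apply a)
  then show ?thesis
    unfolding preserving_def using A.permutes[OF a] A_preserves[OF a] by blast
qed

definition left_parts :: "(nat \<Rightarrow> nat) set" where "left_parts = {p. \<exists>q. preserving p q}"

lemma left_parts_subgroup: "subgroup left_parts (sym_group n)"
proof -
  have "permutation_group n left_parts"
  proof (rule permutation_groupI)
    show "id \<in> left_parts" using preserving_diagonal[OF A.id_mem] by (auto simp: left_parts_def)
    show "x permutes {1..n}" if "x \<in> left_parts" for x
      using that by (auto simp: left_parts_def preserving_def)
    show "x \<circ> y \<in> left_parts" if "x \<in> left_parts" "y \<in> left_parts" for x y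
      using that preserving_comp unfolding left_parts_def by blast
    show "inv' x \<in> left_parts" if "x \<in> left_parts" for x
      using that preserving_inv unfolding left_parts_def by blast
  qed
  then show ?thesis by (rule permutation_group.subgroup_sym)
qed

lemma A_sub_left_parts: "A \<subseteq> left_parts"
  using preserving_diagonal by (auto simp: left_parts_def)

lemma socle_left_parts: "socle (sym_group n\<lparr>carrier := left_parts\<rparr>) = T"
proof (rule overgroup_socle[OF left_parts_subgroup])
  show "G \<subseteq> left_parts" using G_sub_A A_sub_left_parts by blast
  have "\<not> carrier (alt_group n) \<subseteq> left_parts"
  proof
    assume "carrier (alt_group n) \<subseteq> left_parts"
    then show False
      by (intro in_neighbourhoods_not_all_subsets) (auto simp: left_parts_def preserving_def)
  qed
  moreover have "carrier (alt_group n) \<subseteq> carrier (sym_group n)"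
    by (auto simp: alt_group_carrier sym_group_carrier)
  ultimately show "left_parts \<noteq> carrier (alt_group n)" "left_parts \<noteq> carrier (sym_group n)"
    by blast+
qed

lemma finite_sym: "finite (carrier (sym_group n))"
proof -
  have "carrier (sym_group n) = {p. p permutes {1..n}}" by (auto simp: sym_group_carrier)
  then show ?thesis by (simp add: finite_permutations)
qed

lemma T_normal_left_parts: "T \<lhd> sym_group n\<lparr>carrier := left_parts\<rparr>"
  using group.socle_normal[OF S.subgroup_imp_group[OF left_parts_subgroup]] socle_left_parts by simp

lemma centralizer_T_in_left_parts:
  assumes "c \<in> left_parts" "\<forall>t\<in>T. c \<circ> t = t \<circ> c"
  shows "c = id"
proof -
  have "finite left_parts"
    using finite_sym subgroup.subset[OF left_parts_subgroup] by (rule rev_finite_subset)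
  then show ?thesis
    using group.centralizer_of_simple_socle[OF S.subgroup_imp_group[OF left_parts_subgroup], of c]
      assms simple nonab socle_left_parts
    by (simp add: sym_group_mult sym_group_one)
qed

text \<open>An element \<open>x\<close> of the overgroup \<open>left_parts\<close> normalizes its socle \<open>T\<close>, so it induces the same
automorphism of \<open>T\<close> as some \<open>a \<in> A\<close>; then \<open>a\<^sup>-\<^sup>1x\<close> centralizes the simple socle and is trivial.\<close>

lemma left_parts_eq: "left_parts = A"
proof
  interpret L: subgroup left_parts "sym_group n" by (rule left_parts_subgroup)
  interpret T: normal T "sym_group n\<lparr>carrier := left_parts\<rparr>" by (rule T_normal_left_parts)
  show "left_parts \<subseteq> A"
  proof
    fix x assume x: "x \<in> left_parts"
    then have xS: "x \<in> carrier (sym_group n)" by (rule L.mem_carrier)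
    then have x_perm: "x permutes {1..n}" by (simp add: sym_group_carrier)
    have "\<forall>t\<in>T. x \<circ> t \<circ> inv' x \<in> T"
      using T.inv_op_closed2[of x] x x_perm
      by (simp add: S.m_inv_consistent[OF left_parts_subgroup] sym_group_mult sym_group_carrier)
    then obtain a where a: "a \<in> A" "\<And>t. t \<in> T \<Longrightarrow> a \<circ> t \<circ> inv' a = x \<circ> t \<circ> inv' x"
      using A_induces[OF x_perm] by blast
    have aS: "a \<in> carrier (sym_group n)" using a(1) A.permutes by (simp add: sym_group_carrier)
    have "inv' a \<circ> x \<in> left_parts"
      using L.m_closed[of "inv' a" x] A.inv_mem[OF a(1)] A_sub_left_parts x
      by (auto simp: sym_group_mult)
    moreover have "\<forall>t\<in>T. inv' a \<circ> x \<circ> t = t \<circ> (inv' a \<circ> x)"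
    proof
      fix t assume t: "t \<in> T"
      then have tS: "t \<in> carrier (sym_group n)" using T.subset L.subset by auto
      show "inv' a \<circ> x \<circ> t = t \<circ> (inv' a \<circ> x)"
        using S.equal_conjugation_centralizes[OF aS xS tS] a(2)[OF t] aS xS
        by (simp add: sym_group_mult)
    qed
    ultimately have "inv' a \<circ> x = id" by (rule centralizer_T_in_left_parts)
    then have "x = a" using A.inv_eq_iff[OF a(1)] by (simp add: fun_eq_iff)
    then show "x \<in> A" using a(1) by simp
  qed
qed (rule A_sub_left_parts)

text \<open>Both \<open>(p, q)\<close> and \<open>(p, p)\<close> preserve the orbital, so \<open>q \<beta>\<close> and \<open>p \<beta>\<close> have the same in-neighbours.\<close>

theorem preserving_iff: "preserving p q \<longleftrightarrow> p \<in> A \<and> q = p"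
proof
  assume pq: "preserving p q"
  then have p: "p \<in> A" using left_parts_eq by (auto simp: left_parts_def)
  note perm = preservingD(1,2)[OF pq]
  have "q \<beta> = p \<beta>" for \<beta>
  proof (cases "\<beta> \<in> {1..n}")
    case True
    show ?thesis
    proof (rule no_twins)
      fix \<alpha> assume "\<alpha> \<in> {1..n}"
      then have "inv' p \<alpha> \<in> {1..n}" using permutes_in_image[OF permutes_inv[OF perm(1)]] by simp
      then show "(\<alpha>, q \<beta>) \<in> orb \<longleftrightarrow> (\<alpha>, p \<beta>) \<in> orb"
        using preservingD(3)[OF pq, of "inv' p \<alpha>" \<beta>] True
          preservingD(3)[OF preserving_diagonal[OF p], of "inv' p \<alpha>" \<beta>]
        by (simp add: permutes_inverses[OF perm(1)])
    qed (use True permutes_in_image[OF perm(1)] permutes_in_image[OF perm(2)] in simp_all)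
  next
    case False
    then show ?thesis using perm by (simp add: permutes_not_in)
  qed
  then show "p \<in> A \<and> q = p" using p by blast
qed (simp add: preserving_diagonal)

text \<open>The pair \<open>(p, q)\<close> describes a map that exchanges the two copies of the point set. It conjugates
the diagonal pair \<open>(a, a)\<close> into \<open>(qaq\<^sup>-\<^sup>1, pap\<^sup>-\<^sup>1)\<close>, which preserves the orbital and hence is
diagonal with entries in \<open>A\<close>. So \<open>p\<close> lies in the normalizer of \<open>A\<close>, which is \<open>A\<close>, and \<open>p\<^sup>-\<^sup>1q\<close>
centralizes \<open>A\<close>, whence \<open>q = p\<close>. As \<open>p\<close> preserves the orbital and \<open>(p, p)\<close> reverses it, the
orbital would be symmetric.\<close>

theorem no_reversing:
  assumes p: "p permutes {1..n}" and q: "q permutes {1..n}"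
    and rev: "\<And>\<alpha> \<beta>. \<alpha> \<in> {1..n} \<Longrightarrow> \<beta> \<in> {1..n} \<Longrightarrow> (q \<beta>, p \<alpha>) \<in> orb \<longleftrightarrow> (\<alpha>, \<beta>) \<in> orb"
  shows False
proof -
  have inv_range: "inv' p \<alpha> \<in> {1..n}" "inv' q \<alpha> \<in> {1..n}" if "\<alpha> \<in> {1..n}" for \<alpha>
    using that permutes_in_image[OF permutes_inv[OF p]] permutes_in_image[OF permutes_inv[OF q]] by simp_all
  have "preserving (q \<circ> a \<circ> inv' q) (p \<circ> a \<circ> inv' p)" if a: "a \<in> A" for a
    unfolding preserving_def
  proof (intro conjI ballI)
    show "q \<circ> a \<circ> inv' q permutes {1..n}" "p \<circ> a \<circ> inv' p permutes {1..n}"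
      using p q A.permutes[OF a] by (auto intro!: permutes_compose permutes_inv)
    fix \<alpha> \<beta> assume ab: "\<alpha> \<in> {1..n}" "\<beta> \<in> {1..n}"
    have "(q (a (inv' q \<alpha>)), p (a (inv' p \<beta>))) \<in> orb \<longleftrightarrow> (a (inv' p \<beta>), a (inv' q \<alpha>)) \<in> orb"
      by (rule rev) (use ab inv_range A.in_range[OF a] in auto)
    also have "\<dots> \<longleftrightarrow> (inv' p \<beta>, inv' q \<alpha>) \<in> orb"
      using preservingD(3)[OF preserving_diagonal[OF a]] ab inv_range by blast
    also have "\<dots> \<longleftrightarrow> (q (inv' q \<alpha>), p (inv' p \<beta>)) \<in> orb"
      using rev[of "inv' p \<beta>" "inv' q \<alpha>"] ab inv_range by blast
    finally show "((q \<circ> a \<circ> inv' q) \<alpha>, (p \<circ> a \<circ> inv' p) \<beta>) \<in> orb \<longleftrightarrow> (\<alpha>, \<beta>) \<in> orb"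
      by (simp add: permutes_inverses[OF p] permutes_inverses[OF q])
  qed
  then have conj: "q \<circ> a \<circ> inv' q \<in> A" "p \<circ> a \<circ> inv' p = q \<circ> a \<circ> inv' q" if "a \<in> A" for a
    using preserving_iff that by blast+
  have "p \<in> A"
  proof (rule S.self_normalizing_if_all_automorphisms_inner[OF finite_sym A])
    show "T \<lhd> sym_group n\<lparr>carrier := A\<rparr>" using T_normal_left_parts by (simp add: left_parts_eq)
    show "c = \<one>\<^bsub>sym_group n\<^esub>"
      if "c \<in> A" "\<forall>t\<in>T. c \<otimes>\<^bsub>sym_group n\<^esub> t = t \<otimes>\<^bsub>sym_group n\<^esub> c" for c
      using centralizer_T_in_left_parts that
      by (simp add: left_parts_eq sym_group_mult sym_group_one)
    show "\<exists>a\<in>A. \<forall>t\<in>T. a \<otimes>\<^bsub>sym_group n\<^esub> t \<otimes>\<^bsub>sym_group n\<^esub> inv\<^bsub>sym_group n\<^esub> a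
        = x \<otimes>\<^bsub>sym_group n\<^esub> t \<otimes>\<^bsub>sym_group n\<^esub> inv\<^bsub>sym_group n\<^esub> x"
      if "x \<in> carrier (sym_group n)"
        "\<forall>t\<in>T. x \<otimes>\<^bsub>sym_group n\<^esub> t \<otimes>\<^bsub>sym_group n\<^esub> inv\<^bsub>sym_group n\<^esub> x \<in> T" for x
      using A_induces[of x] that A.permutes by (simp add: sym_group_mult sym_group_carrier)
    show "c = \<one>\<^bsub>sym_group n\<^esub>"
      if "c \<in> carrier (sym_group n)" "\<forall>a\<in>A. c \<otimes>\<^bsub>sym_group n\<^esub> a = a \<otimes>\<^bsub>sym_group n\<^esub> c" for c
      using commuting_permutation_trivial[of c] that G_sub_A
      by (auto simp: sym_group_carrier sym_group_mult sym_group_one)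
    show "p \<in> carrier (sym_group n)" using p by (simp add: sym_group_carrier)
    show "\<forall>a\<in>A. p \<otimes>\<^bsub>sym_group n\<^esub> a \<otimes>\<^bsub>sym_group n\<^esub> inv\<^bsub>sym_group n\<^esub> p \<in> A"
      using conj p by (simp add: sym_group_mult sym_group_carrier)
  qed (rule simple)
  have "inv' p \<circ> q = id"
  proof (rule commuting_permutation_trivial)
    show "inv' p \<circ> q permutes {1..n}" using p q by (intro permutes_compose permutes_inv)
    fix x assume "x \<in> G"
    then have "p \<circ> x \<circ> inv' p = q \<circ> x \<circ> inv' q" using conj(2) G_sub_A by blast
    then have "p (x (inv' p (q \<alpha>))) = q (x \<alpha>)" for \<alpha>
      by (simp add: fun_eq_iff permutes_inverses[OF q])
    then have "x (inv' p (q \<alpha>)) = inv' p (q (x \<alpha>))" for \<alpha>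
      by (metis permutes_inverses(2)[OF p])
    then show "(inv' p \<circ> q) \<circ> x = x \<circ> (inv' p \<circ> q)" by (simp add: fun_eq_iff)
  qed
  then have "q \<alpha> = p \<alpha>" for \<alpha>
    by (metis comp_apply id_apply permutes_inverses(1)[OF p])
  then have "(p \<delta>, p \<omega>) \<in> orb" using rev[OF \<omega> \<delta>] orb_base by simp
  then have "(\<delta>, \<omega>) \<in> orb"
    using preservingD(3)[OF preserving_diagonal[OF \<open>p \<in> A\<close>] \<delta> \<omega>] by simp
  then show False using orb_asym orb_base by blast
qed

end

section \<open>The graph of an orbital\<close>

text \<open>The point set \<open>{1..n}\<close> occurs inside the term for the graph and is kept in this form.\<close>

declare One_nat_def [simp del]

text \<open>The bipartite double of the digraph \<open>(V, E)\<close>, with each point \<open>\<alpha>\<close> replaced by a label \<open>C \<alpha>\<close>. For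
bi-coset graphs the labels are cosets.\<close>

definition labelled_bigraph :: "('b \<Rightarrow> 'c) \<Rightarrow> 'b set \<Rightarrow> ('b \<times> 'b) set \<Rightarrow> ('c + 'c) sgraph" where
  "labelled_bigraph C V E =
    \<lparr>vertices = Inl ` C ` V \<union> Inr ` C ` V, edges = {{Inl (C \<alpha>), Inr (C \<beta>)} |\<alpha> \<beta>. (\<alpha>, \<beta>) \<in> E}\<rparr>"

lemma induced_permutation:
  assumes fin: "finite V" and inj: "inj_on u V" and sub: "\<And>\<alpha>. \<alpha> \<in> V \<Longrightarrow> u \<alpha> \<in> v ` V"
  obtains p where "p permutes V" "\<And>\<alpha>. \<alpha> \<in> V \<Longrightarrow> u \<alpha> = v (p \<alpha>)"
proof -
  have "\<forall>\<alpha>\<in>V. \<exists>\<beta>. \<beta> \<in> V \<and> u \<alpha> = v \<beta>" using sub by blast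
  then obtain h where h: "\<And>\<alpha>. \<alpha> \<in> V \<Longrightarrow> h \<alpha> \<in> V" "\<And>\<alpha>. \<alpha> \<in> V \<Longrightarrow> u \<alpha> = v (h \<alpha>)"
    by (auto dest!: bchoice)
  define p where "p \<alpha> = (if \<alpha> \<in> V then h \<alpha> else \<alpha>)" for \<alpha>
  have "inj_on p V" using inj h by (auto simp: inj_on_def p_def)
  moreover have "p ` V \<subseteq> V" using h by (auto simp: p_def)
  ultimately have "bij_betw p V V" using fin by (simp add: bij_betw_def endo_inj_surj)
  then have "p permutes V" by (rule bij_imp_permutes) (simp add: p_def)
  then show thesis using that h by (simp add: p_def)
qed

locale labelled_orbital = saturated_orbital +
  fixes C :: "nat \<Rightarrow> 'c"
  assumes inj_C: "inj_on C {1..n}"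
begin

abbreviation \<Gamma> :: "('c + 'c) sgraph" where "\<Gamma> \<equiv> labelled_bigraph C {1..n} orb"

lemma vertices_\<Gamma>: "vertices \<Gamma> = Inl ` C ` {1..n} \<union> Inr ` C ` {1..n}"
  by (simp add: labelled_bigraph_def)

lemma C_eq_iff: "\<alpha> \<in> {1..n} \<Longrightarrow> \<beta> \<in> {1..n} \<Longrightarrow> C \<alpha> = C \<beta> \<longleftrightarrow> \<alpha> = \<beta>"
  using inj_C by (auto simp: inj_on_def)

lemma edge_iff:
  assumes "\<alpha> \<in> {1..n}" "\<beta> \<in> {1..n}"
  shows "{Inl (C \<alpha>), Inr (C \<beta>)} \<in> edges \<Gamma> \<longleftrightarrow> (\<alpha>, \<beta>) \<in> orb"
proof
  assume "{Inl (C \<alpha>), Inr (C \<beta>)} \<in> edges \<Gamma>"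
  then obtain \<alpha>' \<beta>' where "(\<alpha>', \<beta>') \<in> orb" "C \<alpha> = C \<alpha>'" "C \<beta> = C \<beta>'"
    by (auto simp: labelled_bigraph_def doubleton_eq_iff)
  then show "(\<alpha>, \<beta>) \<in> orb" using assms C_eq_iff orb_range by metis
qed (auto simp: labelled_bigraph_def)

lemma edge_sides: "{u, v} \<in> edges \<Gamma> \<Longrightarrow> isl u \<longleftrightarrow> \<not> isl v"
  by (auto simp: labelled_bigraph_def doubleton_eq_iff)

lemma no_edge_within_side: "{Inl x, Inl y} \<notin> edges \<Gamma>" "{Inr x, Inr y} \<notin> edges \<Gamma>"
  using edge_sides[of "Inl x" "Inl y"] edge_sides[of "Inr x" "Inr y"] by auto

text \<open>The diagonal action of a permutation of the points on the two sets of labels.\<close>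

definition lift :: "(nat \<Rightarrow> nat) \<Rightarrow> 'c + 'c \<Rightarrow> 'c + 'c" where
  "lift a = (\<lambda>v\<in>vertices \<Gamma>. map_sum (C \<circ> a \<circ> the_inv_into {1..n} C) (C \<circ> a \<circ> the_inv_into {1..n} C) v)"

lemma lift_apply:
  assumes "\<alpha> \<in> {1..n}"
  shows "lift a (Inl (C \<alpha>)) = Inl (C (a \<alpha>))" "lift a (Inr (C \<alpha>)) = Inr (C (a \<alpha>))"
  using assms the_inv_into_f_f[OF inj_C assms] by (auto simp: lift_def vertices_\<Gamma>)

lemma vertex_cases:
  assumes "v \<in> vertices \<Gamma>"
  obtains \<alpha> where "\<alpha> \<in> {1..n}" "v = Inl (C \<alpha>)" | \<alpha> where "\<alpha> \<in> {1..n}" "v = Inr (C \<alpha>)"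
  using assms by (auto simp: vertices_\<Gamma>)

lemma lift_vertex: "a \<in> A \<Longrightarrow> v \<in> vertices \<Gamma> \<Longrightarrow> lift a v \<in> vertices \<Gamma>"
  by (erule vertex_cases) (auto simp: lift_apply vertices_\<Gamma> A.in_range)

lemma lift_comp:
  assumes "a \<in> A" "b \<in> A"
  shows "lift (a \<circ> b) = compose (vertices \<Gamma>) (lift a) (lift b)"
proof
  fix v show "lift (a \<circ> b) v = compose (vertices \<Gamma>) (lift a) (lift b) v"
  proof (cases "v \<in> vertices \<Gamma>")
    case True
    then show ?thesis
      by (rule vertex_cases) (use True assms in \<open>auto simp: lift_apply compose_def A.in_range\<close>)
  qed (simp add: lift_def compose_def)
qed

lemma lift_automorphism: 
  assumes a: "a \<in> A" shows "lift a \<in> graph_auto \<Gamma>"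
  unfolding graph_auto_def
proof (intro CollectI conjI ballI)
  have inverse: "lift (inv' b) (lift b v) = v" if "b \<in> A" "v \<in> vertices \<Gamma>" for b v
    using that(2) by (rule vertex_cases) (simp_all add: lift_apply A.in_range A.inv_apply that(1))
  have "lift a \<in> extensional (vertices \<Gamma>)" unfolding lift_def by simp
  moreover have "bij_betw (lift a) (vertices \<Gamma>) (vertices \<Gamma>)"
  proof (rule bij_betw_byWitness[where f' = "lift (inv' a)"])
    have "inv' (inv' a) = a" using A.permutes[OF a] by (simp add: inv_inv_eq permutes_bij)
    then show "\<forall>v\<in>vertices \<Gamma>. lift a (lift (inv' a) v) = v"
      using inverse[OF A.inv_mem[OF a]] by simp
  qed (use a inverse lift_vertex A.inv_mem in auto)
  ultimately show "lift a \<in> Bij (vertices \<Gamma>)" by (simp add: Bij_def)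
next
  fix u v assume u: "u \<in> vertices \<Gamma>" and v: "v \<in> vertices \<Gamma>"
  have iff: "(a \<alpha>, a \<beta>) \<in> orb \<longleftrightarrow> (\<alpha>, \<beta>) \<in> orb" if "\<alpha> \<in> {1..n}" "\<beta> \<in> {1..n}" for \<alpha> \<beta>
    using preservingD(3)[OF preserving_diagonal[OF a]] that .
  show "{lift a u, lift a v} \<in> edges \<Gamma> \<longleftrightarrow> {u, v} \<in> edges \<Gamma>"
    using u
  proof (cases rule: vertex_cases)
    case u: (1 \<alpha>)
    from v show ?thesis
      by (cases rule: vertex_cases)
        (use u in \<open>auto simp: lift_apply no_edge_within_side edge_iff A.in_range[OF a] iff\<close>)
  next
    case u: (2 \<alpha>)
    from v show ?thesis
      by (cases rule: vertex_cases)
        (use u in \<open>auto simp: lift_apply no_edge_within_side edge_iff A.in_range[OF a] iff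
          insert_commute[of "Inr _" "Inl _"]\<close>)
  qed
qed

text \<open>Adjacent vertices lie on opposite sides, and so do their images under \<open>f\<close>; by connectedness \<open>f\<close>
preserves or exchanges the sides as a whole. It then consists of two permutations of the points,
to which the classification of pairs that preserve or reverse the orbital applies.\<close>

lemma automorphism_is_lift:
  assumes f: "f \<in> graph_auto \<Gamma>"
  obtains a where "a \<in> A" "f = lift a"
proof -
  have ext: "f \<in> extensional (vertices \<Gamma>)" and bij: "bij_betw f (vertices \<Gamma>) (vertices \<Gamma>)"
    using f by (auto simp: graph_auto_def Bij_def)
  have f_edge: "{f u, f v} \<in> edges \<Gamma> \<longleftrightarrow> {u, v} \<in> edges \<Gamma>"
    if "u \<in> vertices \<Gamma>" "v \<in> vertices \<Gamma>" for u v
    using f that by (auto simp: graph_auto_def)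
  have vert: "Inl (C \<alpha>) \<in> vertices \<Gamma>" "Inr (C \<alpha>) \<in> vertices \<Gamma>" if "\<alpha> \<in> {1..n}" for \<alpha>
    using that by (auto simp: vertices_\<Gamma>)
  have f_vert: "f v \<in> vertices \<Gamma>" if "v \<in> vertices \<Gamma>" for v
    using bij that by (auto simp: bij_betw_def)
  have f_inj: "f u = f v \<longleftrightarrow> u = v" if "u \<in> vertices \<Gamma>" "v \<in> vertices \<Gamma>" for u v
    using bij that by (auto simp: bij_betw_def inj_on_def)
  have inj_l: "inj_on (\<lambda>\<alpha>. f (Inl (C \<alpha>))) {1..n}" and inj_r: "inj_on (\<lambda>\<alpha>. f (Inr (C \<alpha>))) {1..n}"
    by (auto intro!: inj_onI simp: f_inj vert C_eq_iff)
  have opposite: "isl (f (Inl (C \<alpha>))) \<longleftrightarrow> \<not> isl (f (Inr (C \<beta>)))" if "(\<alpha>, \<beta>) \<in> orb" for \<alpha> \<beta>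
    using edge_sides f_edge[of "Inl (C \<alpha>)" "Inr (C \<beta>)"] vert orb_range[OF that] edge_iff that by blast
  have left: "isl (f (Inl (C \<alpha>))) \<longleftrightarrow> isl (f (Inl (C \<omega>)))" if "\<alpha> \<in> {1..n}" for \<alpha>
    using connected[of "{\<alpha>. isl (f (Inl (C \<alpha>)))}" \<alpha> \<omega>] connected[of "{\<alpha>. isl (f (Inl (C \<alpha>)))}" \<omega> \<alpha>]
      opposite that \<omega> by blast
  have right: "isl (f (Inr (C \<beta>))) \<longleftrightarrow> \<not> isl (f (Inl (C \<omega>)))" if \<beta>: "\<beta> \<in> {1..n}" for \<beta>
  proof -
    have "orb\<inverse> `` {\<beta>} \<noteq> {}" using in_degree[OF \<beta>] valency_bounds by auto
    then obtain \<alpha> where "(\<alpha>, \<beta>) \<in> orb" by blast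
    then show ?thesis using opposite left orb_range by blast
  qed
  have side: "v \<in> vertices \<Gamma> \<Longrightarrow> isl v \<Longrightarrow> v \<in> (\<lambda>\<alpha>. Inl (C \<alpha>)) ` {1..n}"
    "v \<in> vertices \<Gamma> \<Longrightarrow> \<not> isl v \<Longrightarrow> v \<in> (\<lambda>\<alpha>. Inr (C \<alpha>)) ` {1..n}" for v
    by (auto simp: vertices_\<Gamma>)
  have preserves: "isl (f (Inl (C \<omega>)))"
  proof (rule ccontr)
    assume swap: "\<not> isl (f (Inl (C \<omega>)))"
    obtain p where p: "p permutes {1..n}" "\<And>\<alpha>. \<alpha> \<in> {1..n} \<Longrightarrow> f (Inl (C \<alpha>)) = Inr (C (p \<alpha>))"
      by (rule induced_permutation[OF _ inj_l, of "\<lambda>\<alpha>. Inr (C \<alpha>)"])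
        (use side f_vert vert left swap in auto)
    obtain q where q: "q permutes {1..n}" "\<And>\<alpha>. \<alpha> \<in> {1..n} \<Longrightarrow> f (Inr (C \<alpha>)) = Inl (C (q \<alpha>))"
      by (rule induced_permutation[OF _ inj_r, of "\<lambda>\<alpha>. Inl (C \<alpha>)"])
        (use side f_vert vert right swap in auto)
    show False
    proof (rule no_reversing[OF p(1) q(1)])
      fix \<alpha> \<beta> assume ab: "\<alpha> \<in> {1..n}" "\<beta> \<in> {1..n}"
      have "(q \<beta>, p \<alpha>) \<in> orb \<longleftrightarrow> {Inl (C (q \<beta>)), Inr (C (p \<alpha>))} \<in> edges \<Gamma>"
        using edge_iff permutes_in_image[OF p(1)] permutes_in_image[OF q(1)] ab by simp
      also have "\<dots> \<longleftrightarrow> {f (Inl (C \<alpha>)), f (Inr (C \<beta>))} \<in> edges \<Gamma>"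
        using p q ab by (simp add: insert_commute)
      also have "\<dots> \<longleftrightarrow> (\<alpha>, \<beta>) \<in> orb" using f_edge vert ab edge_iff by simp
      finally show "(q \<beta>, p \<alpha>) \<in> orb \<longleftrightarrow> (\<alpha>, \<beta>) \<in> orb" .
    qed
  qed
  obtain p where p: "p permutes {1..n}" "\<And>\<alpha>. \<alpha> \<in> {1..n} \<Longrightarrow> f (Inl (C \<alpha>)) = Inl (C (p \<alpha>))"
    by (rule induced_permutation[OF _ inj_l, of "\<lambda>\<alpha>. Inl (C \<alpha>)"])
      (use side f_vert vert left preserves in auto)
  obtain q where q: "q permutes {1..n}" "\<And>\<alpha>. \<alpha> \<in> {1..n} \<Longrightarrow> f (Inr (C \<alpha>)) = Inr (C (q \<alpha>))"
    by (rule induced_permutation[OF _ inj_r, of "\<lambda>\<alpha>. Inr (C \<alpha>)"])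
      (use side f_vert vert right preserves in auto)
  have "preserving p q"
    unfolding preserving_def
  proof (intro conjI ballI)
    fix \<alpha> \<beta> assume ab: "\<alpha> \<in> {1..n}" "\<beta> \<in> {1..n}"
    have "(p \<alpha>, q \<beta>) \<in> orb \<longleftrightarrow> {f (Inl (C \<alpha>)), f (Inr (C \<beta>))} \<in> edges \<Gamma>"
      using edge_iff permutes_in_image[OF p(1)] permutes_in_image[OF q(1)] ab p q by simp
    also have "\<dots> \<longleftrightarrow> (\<alpha>, \<beta>) \<in> orb" using f_edge vert ab edge_iff by simp
    finally show "(p \<alpha>, q \<beta>) \<in> orb \<longleftrightarrow> (\<alpha>, \<beta>) \<in> orb" .
  qed (use p q in auto)
  then have pA: "p \<in> A" and qp: "q = p" using preserving_iff by auto
  have "f v = lift p v" for v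
  proof (cases "v \<in> vertices \<Gamma>")
    case True
    then show ?thesis
      by (cases rule: vertex_cases) (simp_all add: lift_apply p(2) q(2)[unfolded qp])
  next
    case False
    then show ?thesis using ext by (simp add: lift_def extensional_def)
  qed
  then show thesis using that pA by blast
qed

lemma lift_iso: "lift \<in> iso (sym_group n\<lparr>carrier := A\<rparr>) (GraphAutoGroup \<Gamma>)"
proof (rule isoI)
  have Bij: "lift a \<in> Bij (vertices \<Gamma>)" if "a \<in> A" for a
    using lift_automorphism[OF that] by (simp add: graph_auto_def)
  show "lift \<in> hom (sym_group n\<lparr>carrier := A\<rparr>) (GraphAutoGroup \<Gamma>)"
    using lift_automorphism
    by (auto simp: hom_def GraphAutoGroup_def BijGroup_def sym_group_mult lift_comp Bij)
  have "inj_on lift A"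
  proof (rule inj_onI)
    fix a b assume ab: "a \<in> A" "b \<in> A" "lift a = lift b"
    show "a = b"
    proof
      fix \<alpha> show "a \<alpha> = b \<alpha>"
      proof (cases "\<alpha> \<in> {1..n}")
        case True
        then have "C (a \<alpha>) = C (b \<alpha>)" using lift_apply(1)[OF True] ab(3) by (metis Inl_inject)
        then show ?thesis using True ab C_eq_iff A.in_range by simp
      next
        case False
        then show ?thesis
          using permutes_not_in[OF A.permutes[OF ab(1)]] permutes_not_in[OF A.permutes[OF ab(2)]]
          by simp
      qed
    qed
  qed
  then show "bij_betw lift (carrier (sym_group n\<lparr>carrier := A\<rparr>)) (carrier (GraphAutoGroup \<Gamma>))"
    using lift_automorphism automorphism_is_lift
    by (auto simp: bij_betw_def GraphAutoGroup_def) blast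
qed

lemma regular_\<Gamma>: "regular_graph \<Gamma>"
  unfolding regular_graph_def
proof (intro exI ballI)
  fix v assume "v \<in> vertices \<Gamma>"
  then show "card {e \<in> edges \<Gamma>. v \<in> e} = valency"
  proof (cases rule: vertex_cases)
    case (1 \<alpha>)
    have "{e \<in> edges \<Gamma>. v \<in> e} = (\<lambda>\<beta>. {Inl (C \<alpha>), Inr (C \<beta>)}) ` (orb `` {\<alpha>})"
    proof
      show "{e \<in> edges \<Gamma>. v \<in> e} \<subseteq> (\<lambda>\<beta>. {Inl (C \<alpha>), Inr (C \<beta>)}) ` (orb `` {\<alpha>})"
      proof clarify
        fix e assume "e \<in> edges \<Gamma>" "v \<in> e"
        then obtain \<alpha>' \<beta> where e: "e = {Inl (C \<alpha>'), Inr (C \<beta>)}" "(\<alpha>', \<beta>) \<in> orb" "C \<alpha>' = C \<alpha>"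
          using 1 by (auto simp: labelled_bigraph_def)
        then have "\<alpha>' = \<alpha>" using C_eq_iff orb_range(1) 1(1) by blast
        then show "e \<in> (\<lambda>\<beta>. {Inl (C \<alpha>), Inr (C \<beta>)}) ` (orb `` {\<alpha>})" using e by blast
      qed
    qed (auto simp: labelled_bigraph_def 1)
    moreover have "inj_on (\<lambda>\<beta>. {Inl (C \<alpha>), Inr (C \<beta>)} :: ('c + 'c) set) (orb `` {\<alpha>})"
      using C_eq_iff orb_range(2) by (fastforce intro!: inj_onI simp: doubleton_eq_iff)
    ultimately show ?thesis using out_degree 1 by (simp add: card_image)
  next
    case (2 \<beta>)
    have "{e \<in> edges \<Gamma>. v \<in> e} = (\<lambda>\<alpha>. {Inl (C \<alpha>), Inr (C \<beta>)}) ` (orb\<inverse> `` {\<beta>})"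
    proof
      show "{e \<in> edges \<Gamma>. v \<in> e} \<subseteq> (\<lambda>\<alpha>. {Inl (C \<alpha>), Inr (C \<beta>)}) ` (orb\<inverse> `` {\<beta>})"
      proof clarify
        fix e assume "e \<in> edges \<Gamma>" "v \<in> e"
        then obtain \<alpha> \<beta>' where e: "e = {Inl (C \<alpha>), Inr (C \<beta>')}" "(\<alpha>, \<beta>') \<in> orb" "C \<beta>' = C \<beta>"
          using 2 by (auto simp: labelled_bigraph_def)
        then have "\<beta>' = \<beta>" using C_eq_iff orb_range(2) 2(1) by blast
        then show "e \<in> (\<lambda>\<alpha>. {Inl (C \<alpha>), Inr (C \<beta>)}) ` (orb\<inverse> `` {\<beta>})" using e by blast
      qed
    qed (auto simp: labelled_bigraph_def 2)
    moreover have "inj_on (\<lambda>\<alpha>. {Inl (C \<alpha>), Inr (C \<beta>)} :: ('c + 'c) set) (orb\<inverse> `` {\<beta>})"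
      using C_eq_iff orb_range(1) by (fastforce intro!: inj_onI simp: doubleton_eq_iff)
    ultimately show ?thesis using in_degree 2 by (simp add: card_image)
  qed
qed

theorem semisymmetric_\<Gamma>: "semisymmetric \<Gamma>"
  unfolding semisymmetric_def
proof (intro conjI)
  show "simple_graph \<Gamma>"
    using orb_range by (auto simp: simple_graph_def labelled_bigraph_def)
  show "regular_graph \<Gamma>" by (rule regular_\<Gamma>)
  show "edge_transitive \<Gamma>"
    unfolding edge_transitive_def
  proof (intro ballI)
    have base: "\<exists>x\<in>G. lift x ` {Inl (C \<omega>), Inr (C \<delta>)} = e" if "e \<in> edges \<Gamma>" for e
      using that \<omega> \<delta> by (auto simp: labelled_bigraph_def orb_def lift_apply)
    fix e e' assume "e \<in> edges \<Gamma>" "e' \<in> edges \<Gamma>"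
    then obtain \<alpha> \<beta> \<alpha>' \<beta>' where e: "e = {Inl (C \<alpha>), Inr (C \<beta>)}" "(\<alpha>, \<beta>) \<in> orb"
      and e': "e' = {Inl (C \<alpha>'), Inr (C \<beta>')}" "(\<alpha>', \<beta>') \<in> orb"
      by (auto simp: labelled_bigraph_def)
    obtain x y where xy: "x \<in> G" "y \<in> G" "\<alpha> = x \<omega>" "\<beta> = x \<delta>" "\<alpha>' = y \<omega>" "\<beta>' = y \<delta>"
      using e(2) e'(2) by (auto simp: orb_def)
    have "y \<circ> inv' x \<in> A" using xy G_sub_A comp_mem inv_mem by blast
    moreover have "lift (y \<circ> inv' x) ` e = e'"
      using orb_range[OF e(2)] xy by (simp add: e(1) e'(1) lift_apply inv_apply)
    ultimately show "\<exists>f\<in>graph_auto \<Gamma>. f ` e = e'" using lift_automorphism by blast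
  qed
  show "\<not> vertex_transitive \<Gamma>"
  proof
    assume "vertex_transitive \<Gamma>"
    moreover have "Inl (C \<omega>) \<in> vertices \<Gamma>" "Inr (C \<omega>) \<in> vertices \<Gamma>"
      using \<omega> by (auto simp: vertices_\<Gamma>)
    ultimately obtain f where f: "f \<in> graph_auto \<Gamma>" "f (Inl (C \<omega>)) = Inr (C \<omega>)"
      unfolding vertex_transitive_def by blast
    obtain a where "f = lift a" using automorphism_is_lift[OF f(1)] .
    then show False using f(2) \<omega> by (simp add: lift_apply)
  qed
qed

end

section \<open>Bi-coset graphs as graphs of orbitals\<close>

lemma (in group) conj_map_in_AutoGroup:
  assumes fin: "finite (carrier G)" and T: "subgroup T G" and x: "x \<in> carrier G"
    and norm: "\<forall>t\<in>T. x \<otimes> t \<otimes> inv x \<in> T"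
  shows "conj_map G T x \<in> carrier (AutoGroup (G\<lparr>carrier := T\<rparr>))"
proof -
  interpret T: subgroup T G by fact
  have "inj_on (conj_map G T x) T" using x by (auto simp: inj_on_def conj_map_def)
  moreover have "conj_map G T x ` T \<subseteq> T" using norm by (auto simp: conj_map_def)
  moreover have "finite T" using fin T.subset by (rule rev_finite_subset)
  ultimately have "bij_betw (conj_map G T x) T T" by (simp add: bij_betw_def endo_inj_surj)
  moreover have "conj_map G T x (s \<otimes> t) = conj_map G T x s \<otimes> conj_map G T x t"
    if "s \<in> T" "t \<in> T" for s t
    using that x by (simp add: conj_map_def m_assoc)
  moreover have "conj_map G T x \<in> extensional T" by (simp add: conj_map_def)
  ultimately show ?thesis
    using norm by (auto simp: AutoGroup_def auto_def Bij_def hom_def conj_map_def)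
qed

text \<open>Conjugating the inner automorphism of \<open>t\<close> by the automorphism \<open>a\<close> gives the inner automorphism
of \<open>a t\<close>.\<close>

lemma (in group) AutoGroup_conj_map:
  assumes T: "subgroup T G" and a: "a \<in> carrier (AutoGroup (G\<lparr>carrier := T\<rparr>))" and t: "t \<in> T"
    and conj: "\<And>s. s \<in> T \<Longrightarrow> conj_map G T s \<in> carrier (AutoGroup (G\<lparr>carrier := T\<rparr>))"
  shows "a \<otimes>\<^bsub>AutoGroup (G\<lparr>carrier := T\<rparr>)\<^esub> conj_map G T t
    = conj_map G T (a t) \<otimes>\<^bsub>AutoGroup (G\<lparr>carrier := T\<rparr>)\<^esub> a"
proof -
  interpret T: subgroup T G by fact
  interpret TG: group "G\<lparr>carrier := T\<rparr>" by (rule subgroup_imp_group[OF T])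
  have hom: "a \<in> hom (G\<lparr>carrier := T\<rparr>) (G\<lparr>carrier := T\<rparr>)" and aB: "a \<in> Bij T"
    using a by (auto simp: AutoGroup_def auto_def)
  interpret a: group_hom "G\<lparr>carrier := T\<rparr>" "G\<lparr>carrier := T\<rparr>" a by unfold_locales (rule hom)
  have aT: "a s \<in> T" if "s \<in> T" for s using a.hom_closed that by simp
  have am: "a (s \<otimes> u) = a s \<otimes> a u" if "s \<in> T" "u \<in> T" for s u using a.hom_mult that by simp
  have ai: "a (inv s) = inv (a s)" if "s \<in> T" for s
    using a.hom_inv[of s] that aT by (simp add: m_inv_consistent[OF T])
  have B: "conj_map G T s \<in> Bij T" if "s \<in> T" for s
    using conj[OF that] by (auto simp: AutoGroup_def auto_def)
  have "compose T a (conj_map G T t) = compose T (conj_map G T (a t)) a"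
  proof
    fix s
    have "a (t \<otimes> s \<otimes> inv t) = a t \<otimes> a s \<otimes> inv (a t)" if s: "s \<in> T"
      by (simp only: am ai s t T.m_closed T.m_inv_closed)
    then show "compose T a (conj_map G T t) s = compose T (conj_map G T (a t)) a s"
      using aT[of s] by (simp add: compose_def conj_map_def)
  qed
  then show ?thesis using aB B[OF t] B[OF aT[OF t]] by (simp add: AutoGroup_def BijGroup_def)
qed

context primitive_group
begin

lemma m_inv_eq: "x \<in> G \<Longrightarrow> inv\<^bsub>sym_group n\<lparr>carrier := G\<rparr>\<^esub> x = inv' x"
  using group.m_inv_consistent[OF sym_group_is_group subgroup_sym] permutes
  by (simp add: sym_group_carrier)

lemma double_coset_stab:
  "double_coset (sym_group n\<lparr>carrier := G\<rparr>) stab x stab = {h \<circ> x \<circ> h' |h h'. h \<in> stab \<and> h' \<in> stab}"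
  by (auto simp: double_coset_def r_coset_def set_mult_def sym_group_mult)

lemma stab_mem: "h \<in> stab \<Longrightarrow> h \<in> G"
  by (simp add: stab_def)

lemma stab_comp: "h \<in> stab \<Longrightarrow> h' \<in> stab \<Longrightarrow> h \<circ> h' \<in> stab"
  by (simp add: stab_def comp_mem)

lemma stab_inv: "h \<in> stab \<Longrightarrow> inv' h \<in> stab"
  by (simp add: stab_def inv_mem inv_eq_iff)

text \<open>If \<open>x\<close> interchanges \<open>\<omega>\<close> and \<open>g\<^sup>-\<^sup>1 \<omega>\<close>, then both \<open>gx\<close> and \<open>xg\<^sup>-\<^sup>1\<close> fix \<open>\<omega>\<close>, and so
\<open>x \<in> Hg \<inter> g\<^sup>-\<^sup>1H\<close>.\<close>

lemma paired_double_cosets_equal: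
  assumes g: "g \<in> G" and x: "x \<in> G" "x \<omega> = inv' g \<omega>" "x (inv' g \<omega>) = \<omega>"
  shows "double_coset (sym_group n\<lparr>carrier := G\<rparr>) stab g stab
    = double_coset (sym_group n\<lparr>carrier := G\<rparr>) stab (inv' g) stab"
proof -
  define h\<^sub>1 where "h\<^sub>1 = g \<circ> x"
  define h\<^sub>2 where "h\<^sub>2 = x \<circ> inv' g"
  have h1: "h\<^sub>1 \<in> stab" using g x by (simp add: h\<^sub>1_def stab_def comp_mem inv_apply)
  have h2: "h\<^sub>2 \<in> stab" using g x by (simp add: h\<^sub>2_def stab_def comp_mem inv_mem)
  have hG: "h\<^sub>1 \<in> G" "h\<^sub>2 \<in> G" using h1 h2 by (auto simp: stab_def)
  have eq: "h\<^sub>2 \<circ> g = inv' g \<circ> h\<^sub>1" using g by (simp add: h\<^sub>1_def h\<^sub>2_def fun_eq_iff inv_apply)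
  have g_eq: "g = inv' h\<^sub>2 \<circ> inv' g \<circ> h\<^sub>1"
  proof
    fix \<alpha>
    have "h\<^sub>2 (g \<alpha>) = inv' g (h\<^sub>1 \<alpha>)" using eq by (simp add: fun_eq_iff)
    then show "g \<alpha> = (inv' h\<^sub>2 \<circ> inv' g \<circ> h\<^sub>1) \<alpha>" using inv_eq_iff[OF hG(2)] by (metis comp_apply)
  qed
  have gi_eq: "inv' g = h\<^sub>2 \<circ> g \<circ> inv' h\<^sub>1"
  proof
    fix \<alpha>
    have "h\<^sub>2 (g (inv' h\<^sub>1 \<alpha>)) = inv' g (h\<^sub>1 (inv' h\<^sub>1 \<alpha>))" using eq by (simp add: fun_eq_iff)
    then show "inv' g \<alpha> = (h\<^sub>2 \<circ> g \<circ> inv' h\<^sub>1) \<alpha>" by (simp add: inv_apply hG)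
  qed
  have "h \<circ> g \<circ> h' = (h \<circ> inv' h\<^sub>2) \<circ> inv' g \<circ> (h\<^sub>1 \<circ> h')" for h h'
    by (subst g_eq) (simp only: comp_assoc)
  moreover have "h \<circ> inv' g \<circ> h' = (h \<circ> h\<^sub>2) \<circ> g \<circ> (inv' h\<^sub>1 \<circ> h')" for h h'
    by (subst gi_eq) (simp only: comp_assoc)
  ultimately show ?thesis
    unfolding double_coset_stab using h1 h2 stab_comp stab_inv by blast
qed

text \<open>The right coset of the stabilizer that is labelled by \<open>\<alpha>\<close>: the coset of \<open>x\<close> belongs to the point
\<open>x\<^sup>-\<^sup>1 \<omega>\<close>, because permutations act from the left.\<close>

definition moving_to_base :: "nat \<Rightarrow> (nat \<Rightarrow> nat) set" where
  "moving_to_base \<alpha> = {y\<in>G. y \<alpha> = \<omega>}"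

lemma inj_moving_to_base: "inj_on moving_to_base {1..n}"
proof (rule inj_onI)
  fix \<alpha> \<beta> assume \<alpha>: "\<alpha> \<in> {1..n}" and eq: "moving_to_base \<alpha> = moving_to_base \<beta>"
  obtain y where y: "y \<in> G" "y \<alpha> = \<omega>" using transitiveE[OF \<alpha> \<omega>] .
  then have "y \<in> moving_to_base \<beta>" by (simp add: eq[symmetric]) (simp add: moving_to_base_def)
  then have "y \<alpha> = y \<beta>" using y by (simp add: moving_to_base_def)
  then show "\<alpha> = \<beta>" using apply_eq_iff y by simp
qed

lemma stab_coset:
  assumes x: "x \<in> G"
  shows "stab #>\<^bsub>sym_group n\<lparr>carrier := G\<rparr>\<^esub> x = moving_to_base (inv' x \<omega>)"
proof
  show "stab #>\<^bsub>sym_group n\<lparr>carrier := G\<rparr>\<^esub> x \<subseteq> moving_to_base (inv' x \<omega>)"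
    using x by (auto simp: r_coset_def moving_to_base_def stab_def sym_group_mult comp_mem inv_apply)
  show "moving_to_base (inv' x \<omega>) \<subseteq> stab #>\<^bsub>sym_group n\<lparr>carrier := G\<rparr>\<^esub> x"
  proof
    fix y assume y: "y \<in> moving_to_base (inv' x \<omega>)"
    then have "y \<circ> inv' x \<in> stab" using x by (simp add: moving_to_base_def stab_def comp_mem inv_mem)
    moreover have "y = (y \<circ> inv' x) \<circ> x" using x by (simp add: fun_eq_iff inv_apply)
    ultimately show "y \<in> stab #>\<^bsub>sym_group n\<lparr>carrier := G\<rparr>\<^esub> x"
      by (auto simp: r_coset_def sym_group_mult)
  qed
qed

lemma rcosets_stab: "rcosets\<^bsub>sym_group n\<lparr>carrier := G\<rparr>\<^esub> stab = moving_to_base ` {1..n}"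
proof
  show "rcosets\<^bsub>sym_group n\<lparr>carrier := G\<rparr>\<^esub> stab \<subseteq> moving_to_base ` {1..n}"
    using stab_coset inv_mem in_range \<omega> by (auto simp: RCOSETS_def)
  show "moving_to_base ` {1..n} \<subseteq> rcosets\<^bsub>sym_group n\<lparr>carrier := G\<rparr>\<^esub> stab"
  proof clarify
    fix \<alpha> assume \<alpha>: "\<alpha> \<in> {1..n}"
    obtain x where x: "x \<in> G" "x \<alpha> = \<omega>" using transitiveE[OF \<alpha> \<omega>] .
    then have "inv' x \<omega> = \<alpha>" using inv_eq_iff by simp
    then have "moving_to_base \<alpha> = stab #>\<^bsub>sym_group n\<lparr>carrier := G\<rparr>\<^esub> x" using stab_coset x by simp
    then show "moving_to_base \<alpha> \<in> rcosets\<^bsub>sym_group n\<lparr>carrier := G\<rparr>\<^esub> stab"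
      using x by (auto simp: RCOSETS_def)
  qed
qed

text \<open>For \<open>d = hgh'\<close> with \<open>h, h' \<in> H\<close>, the cosets of \<open>x\<close> and \<open>dx\<close> belong to the points \<open>y \<omega>\<close> and
\<open>y (g\<^sup>-\<^sup>1 \<omega>)\<close> where \<open>y = (h'x)\<^sup>-\<^sup>1\<close>.\<close>

lemma bicoset_graph_eq:
  assumes g: "g \<in> G"
  shows "bicoset_graph (sym_group n\<lparr>carrier := G\<rparr>) stab stab
      (double_coset (sym_group n\<lparr>carrier := G\<rparr>) stab g stab)
    = labelled_bigraph moving_to_base {1..n} {(x \<omega>, x (inv' g \<omega>)) |x. x \<in> G}"
    (is "?B = ?\<Gamma>")
proof -
  let ?C = moving_to_base and ?PG = "sym_group n\<lparr>carrier := G\<rparr>"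
  let ?D = "double_coset ?PG stab g stab"
  have inv_comp: "inv' (x \<circ> y) \<alpha> = inv' y (inv' x \<alpha>)" if "x \<in> G" "y \<in> G" for x y \<alpha>
    using that by (simp add: inv_eq_iff comp_mem inv_apply)
  have D_mem: "d \<in> G" if "d \<in> ?D" for d
    using that g unfolding double_coset_stab by (auto simp: comp_mem stab_mem)
  have "edges ?B = {{Inl (?C (inv' x \<omega>)), Inr (?C (inv' (d \<circ> x) \<omega>))} |x d. x \<in> G \<and> d \<in> ?D}"
    unfolding bicoset_graph_def sgraph.simps
    by (intro Collect_cong ex_cong1 iffI; elim conjE; intro conjI)
      (simp_all add: stab_coset[simplified] D_mem comp_mem sym_group_mult)
  also have "\<dots> = edges ?\<Gamma>"
  proof (intro equalityI subsetI)
    fix e assume "e \<in> {{Inl (?C (inv' x \<omega>)), Inr (?C (inv' (d \<circ> x) \<omega>))} |x d. x \<in> G \<and> d \<in> ?D}"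
    then obtain x h h' where e: "e = {Inl (?C (inv' x \<omega>)), Inr (?C (inv' (h \<circ> g \<circ> h' \<circ> x) \<omega>))}"
      and x: "x \<in> G" and h: "h \<in> stab" "h' \<in> stab" by (auto simp: double_coset_stab)
    have hG: "h \<in> G" "h' \<in> G" and fix_\<omega>: "inv' h \<omega> = \<omega>" "inv' h' \<omega> = \<omega>"
      using h by (auto simp: stab_def inv_eq_iff)
    have y: "inv' x \<circ> inv' h' \<in> G" using x hG by (simp add: comp_mem inv_mem)
    have "inv' (h \<circ> g \<circ> h' \<circ> x) \<omega> = (inv' x \<circ> inv' h') (inv' g \<omega>)"
      using x hG g fix_\<omega> by (simp add: inv_comp comp_mem)
    moreover have "inv' x \<omega> = (inv' x \<circ> inv' h') \<omega>" using fix_\<omega> by simp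
    ultimately have "e = {Inl (?C (y \<omega>)), Inr (?C (y (inv' g \<omega>)))}" if "y = inv' x \<circ> inv' h'" for y
      using that by (simp add: e)
    then obtain y where "y \<in> G" "e = {Inl (?C (y \<omega>)), Inr (?C (y (inv' g \<omega>)))}" using y by blast
    then show "e \<in> edges ?\<Gamma>" by (auto simp: labelled_bigraph_def)
  next
    fix e assume "e \<in> edges ?\<Gamma>"
    then obtain y where e: "e = {Inl (?C (y \<omega>)), Inr (?C (y (inv' g \<omega>)))}" and y: "y \<in> G"
      by (auto simp: labelled_bigraph_def)
    have "inv' (inv' y) \<alpha> = y \<alpha>" for \<alpha> using y by (simp add: inv_eq_iff inv_mem inv_apply)
    then have "e = {Inl (?C (inv' (inv' y) \<omega>)), Inr (?C (inv' (g \<circ> inv' y) \<omega>))}"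
      using e y g by (simp add: inv_comp inv_mem)
    moreover have "g \<in> ?D"
      unfolding double_coset_stab using id_mem by (auto simp: stab_def intro!: exI[of _ id])
    ultimately show "e \<in> {{Inl (?C (inv' x \<omega>)), Inr (?C (inv' (d \<circ> x) \<omega>))} |x d. x \<in> G \<and> d \<in> ?D}"
      using inv_mem[OF y] by blast
  qed
  finally have "edges ?B = edges ?\<Gamma>" .
  moreover have "vertices ?B = vertices ?\<Gamma>"
    by (simp add: bicoset_graph_def labelled_bigraph_def rcosets_stab)
  ultimately show ?thesis by simp
qed

end

section \<open>The automorphism group of the bi-coset graph\<close>

theorem theorem1p1:
  fixes n \<omega> :: nat
    and G T H :: "(nat \<Rightarrow> nat) set"
    and g :: "nat \<Rightarrow> nat"
    and K :: "((nat \<Rightarrow> nat) \<Rightarrow> (nat \<Rightarrow> nat)) set"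
  defines "PG \<equiv> sym_group n\<lparr>carrier := G\<rparr>"
    and "A \<equiv> AutoGroup (sym_group n\<lparr>carrier := T\<rparr>)"
    and "\<iota> \<equiv> conj_map (sym_group n\<lparr>carrier := G\<rparr>) T"
  assumes G: "subgroup G (sym_group n)"
    and almost_simple: "almost_simple_with_socle PG T"
    and primitive: "primitive_on G {1..n}"
    and \<omega>: "\<omega> \<in> {1..n}"
    and H: "H = stabilizer PG id \<omega>"
    and g: "g \<in> G"
    and a: "double_coset PG H g H \<noteq> double_coset PG H (inv\<^bsub>PG\<^esub> g) H"
    and b: "\<forall>Y. subgroup Y (sym_group n) \<and> G \<subseteq> Y \<and>
              Y \<noteq> carrier (alt_group n) \<and> Y \<noteq> carrier (sym_group n) \<longrightarrow>
              socle (sym_group n\<lparr>carrier := Y\<rparr>) = T"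
    and c_maximal: "maximal_subgroup K A"
    and c_core_free: "core_free K A"
    and c_contains: "\<iota> ` H \<subseteq> K"
    and c_factorization:
      "carrier A = (\<iota> ` G) <#>\<^bsub>A\<^esub> (K \<inter> (inv\<^bsub>A\<^esub> (\<iota> g) <#\<^bsub>A\<^esub> K #>\<^bsub>A\<^esub> \<iota> g))"
  shows "semisymmetric (bicoset_graph PG H H (double_coset PG H g H)) \<and>
         GraphAutoGroup (bicoset_graph PG H H (double_coset PG H g H)) \<cong> A"
proof -
  let ?S = "sym_group n"
  interpret S: group ?S by (rule sym_group_is_group)
  interpret P: permutation_group n G by (rule permutation_group.intro) (rule G)
  have T_sub: "subgroup T PG" and simple: "simple_group (?S\<lparr>carrier := T\<rparr>)"
    and nonab: "\<not> comm_group (?S\<lparr>carrier := T\<rparr>)" and mon: "\<iota> \<in> mon PG A"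
    using almost_simple by (simp_all add: almost_simple_with_socle_def PG_def A_def \<iota>_def)
  have T_G: "T \<subseteq> G" using subgroup.subset[OF T_sub] by (simp add: PG_def)
  have T: "subgroup T ?S" using S.incl_subgroup[OF G] T_sub by (simp add: PG_def)
  interpret TG: simple_group "?S\<lparr>carrier := T\<rparr>" by (rule simple)
  interpret A: group A unfolding A_def by (rule TG.AutoGroup)
  interpret K: subgroup K A using c_maximal by (simp add: maximal_subgroup_def)
  have nonabelian: "\<exists>s\<in>G. \<exists>t\<in>G. s \<circ> t \<noteq> t \<circ> s"
  proof (rule ccontr)
    assume "\<not> (\<exists>s\<in>G. \<exists>t\<in>G. s \<circ> t \<noteq> t \<circ> s)"
    then have "comm_group (?S\<lparr>carrier := T\<rparr>)"
      using T_G by (intro TG.group_comm_groupI) (auto simp: sym_group_mult)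
    then show False using nonab by simp
  qed
  interpret P: primitive_group n G \<omega> by unfold_locales (fact primitive \<omega> nonabelian)+
  have H_eq: "H = P.stab" by (auto simp: H stabilizer_def P.stab_def PG_def)
  have inv_PG: "inv\<^bsub>PG\<^esub> x = inv' x" if "x \<in> G" for x using P.m_inv_eq[OF that] by (simp add: PG_def)

  have \<iota>_hom: "\<iota> \<in> hom PG A" using mon by (simp add: mon_def)
  have \<iota>_carr[simp]: "\<iota> x \<in> carrier A" if "x \<in> G" for x
    using \<iota>_hom that by (auto simp: hom_def PG_def)
  have \<iota>_comp: "\<iota> (x \<circ> y) = \<iota> x \<otimes>\<^bsub>A\<^esub> \<iota> y" if "x \<in> G" "y \<in> G" for x y
    using hom_mult[OF \<iota>_hom, of x y] that by (simp add: PG_def sym_group_mult)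
  have \<iota>_eq: "\<iota> x = conj_map ?S T x" if "x \<in> G" for x
    using that inv_PG[OF that] P.permutes[OF that]
    by (simp add: \<iota>_def conj_map_def PG_def sym_group_carrier)
  let ?K\<^sub>g = "K \<inter> (inv\<^bsub>A\<^esub> (\<iota> g) <#\<^bsub>A\<^esub> K #>\<^bsub>A\<^esub> \<iota> g)"
  have factor: "\<exists>z\<in>G. \<exists>k\<in>?K\<^sub>g. a = \<iota> z \<otimes>\<^bsub>A\<^esub> k" if "a \<in> carrier A" for a
    using that c_factorization by (auto simp: set_mult_def)

  \<comment> \<open>\<open>G \<inter> K = H\<close>: otherwise \<open>G \<le> K\<close> by maximality of \<open>H\<close>, and the factorization gives \<open>K = Aut(T)\<close>\<close>
  have stabilizer: "\<iota> x \<in> K \<longleftrightarrow> x \<omega> = \<omega>" if x: "x \<in> G" for x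
  proof
    assume "x \<omega> = \<omega>"
    then show "\<iota> x \<in> K" using c_contains x by (auto simp: H_eq P.stab_def)
  next
    assume xK: "\<iota> x \<in> K"
    show "x \<omega> = \<omega>"
    proof (rule ccontr)
      assume ne: "x \<omega> \<noteq> \<omega>"
      have \<iota>_inv: "\<iota> (inv' y) = inv\<^bsub>A\<^esub> \<iota> y" if "y \<in> G" for y
      proof -
        have "\<iota> id \<otimes>\<^bsub>A\<^esub> \<iota> id = \<iota> id" using \<iota>_comp[OF P.id_mem P.id_mem] by simp
        then have "\<iota> id = \<one>\<^bsub>A\<^esub>" using P.id_mem by simp
        then have "\<iota> (inv' y) \<otimes>\<^bsub>A\<^esub> \<iota> y = \<one>\<^bsub>A\<^esub>"
          using \<iota>_comp[OF P.inv_mem[OF that] that] permutes_inv_o(2)[OF P.permutes[OF that]] by simp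
        then show ?thesis using that by (simp add: A.inv_equality P.inv_mem)
      qed
      have "{y\<in>G. \<iota> y \<in> K} = G"
      proof (rule P.stab_maximal)
        show "P.stab \<subseteq> {y\<in>G. \<iota> y \<in> K}" using c_contains by (auto simp: H_eq P.stab_def)
        show "x \<in> {y\<in>G. \<iota> y \<in> K}" using x xK by simp
        show "x \<notin> P.stab" using ne by (simp add: P.stab_def)
      qed (auto simp: \<iota>_comp \<iota>_inv P.comp_mem P.inv_mem)
      then have "a \<in> K" if "a \<in> carrier A" for a using factor[OF that] by auto
      then have "K = carrier A" using K.subset by blast
      then show False using c_maximal by (simp add: maximal_subgroup_def)
    qed
  qed
  have "carrier A = \<iota> ` G <#>\<^bsub>A\<^esub> K"
  proof
    show "carrier A \<subseteq> \<iota> ` G <#>\<^bsub>A\<^esub> K" using factor by (fastforce simp: set_mult_def)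
    show "\<iota> ` G <#>\<^bsub>A\<^esub> K \<subseteq> carrier A" by (auto simp: set_mult_def)
  qed
  then obtain \<rho> where \<rho>_hom: "\<rho> \<in> hom A ?S" and \<rho>_\<iota>: "\<And>x. x \<in> G \<Longrightarrow> \<rho> (\<iota> x) = x"
    and \<rho>_stab: "\<And>a. a \<in> carrier A \<Longrightarrow> \<rho> a \<omega> = \<omega> \<longleftrightarrow> a \<in> K"
    using extend_permutation_group[OF A.is_group K.subgroup_axioms G, of \<iota> \<omega>]
      \<iota>_hom primitive \<omega> stabilizer
    unfolding PG_def primitive_on_def by blast
  interpret \<rho>: group_hom A ?S \<rho> by unfold_locales (rule \<rho>_hom)
  have \<rho>_comp: "\<rho> (a \<otimes>\<^bsub>A\<^esub> b) = \<rho> a \<circ> \<rho> b" if "a \<in> carrier A" "b \<in> carrier A" for a b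
    using \<rho>.hom_mult[OF that] by (simp add: sym_group_mult)
  have \<rho>_perm: "\<rho> a permutes {1..n}" if "a \<in> carrier A" for a
    using \<rho>.hom_closed[OF that] by (simp add: sym_group_carrier)

  \<comment> \<open>\<open>Aut(T)\<close> acts faithfully on the points since \<open>K\<close> is core-free\<close>
  have "kernel A ?S \<rho> \<subseteq> K" by (auto simp: kernel_def sym_group_one simp flip: \<rho>_stab)
  then have "kernel A ?S \<rho> = {\<one>\<^bsub>A\<^esub>}"
    using c_core_free \<rho>.normal_kernel by (simp add: core_free_def)
  then have \<rho>_inj: "inj_on \<rho> (carrier A)" by (rule \<rho>.trivial_ker_imp_inj)

  let ?A' = "\<rho> ` carrier A"
  interpret orbital: unpaired_orbital n G \<omega> "inv' g \<omega>"
  proof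
    show "inv' g \<omega> \<in> {1..n}" using P.in_range[OF P.inv_mem[OF g]] \<omega> by simp
    show "x (inv' g \<omega>) \<noteq> \<omega>" if "x \<in> G" "x \<omega> = inv' g \<omega>" for x
      using a P.paired_double_cosets_equal[OF g that] inv_PG[OF g] by (auto simp: H_eq PG_def)
  qed

  \<comment> \<open>\<open>Aut(T)\<close> preserves the orbital: an element of \<open>K \<inter> K\<^sup>g\<close> fixes both \<open>\<omega>\<close> and \<open>g\<^sup>-\<^sup>1 \<omega>\<close>\<close>
  have preserves: "(\<rho> a \<alpha>, \<rho> a \<beta>) \<in> orbital.orb" if a: "a \<in> carrier A" and ab: "(\<alpha>, \<beta>) \<in> orbital.orb" for a \<alpha> \<beta>
  proof -
    obtain x where x: "x \<in> G" "\<alpha> = x \<omega>" "\<beta> = x (inv' g \<omega>)" using ab by (auto simp: orbital.orb_def)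
    obtain z k where z: "z \<in> G" and k: "k \<in> ?K\<^sub>g" and eq: "a \<otimes>\<^bsub>A\<^esub> \<iota> x = \<iota> z \<otimes>\<^bsub>A\<^esub> k"
      using factor[of "a \<otimes>\<^bsub>A\<^esub> \<iota> x"] a x by auto
    obtain k' where k': "k' \<in> K" "k = inv\<^bsub>A\<^esub> (\<iota> g) \<otimes>\<^bsub>A\<^esub> k' \<otimes>\<^bsub>A\<^esub> \<iota> g"
      using k by (auto simp: l_coset_def r_coset_def)
    have kA: "k \<in> carrier A" "k' \<in> carrier A" using k k' by auto
    have act: "\<rho> a (x \<gamma>) = z (\<rho> k \<gamma>)" for \<gamma>
      using arg_cong[OF eq, of \<rho>] a x z kA by (simp add: sym_group_mult \<rho>_comp \<rho>_\<iota> fun_eq_iff)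
    have "\<iota> g \<otimes>\<^bsub>A\<^esub> k = k' \<otimes>\<^bsub>A\<^esub> \<iota> g" using k'(2) kA g by (simp add: A.m_assoc)
    then have "\<rho> (\<iota> g \<otimes>\<^bsub>A\<^esub> k) = \<rho> (k' \<otimes>\<^bsub>A\<^esub> \<iota> g)" by simp
    then have "g \<circ> \<rho> k = \<rho> k' \<circ> g"
      using g kA by (simp add: sym_group_mult \<rho>_comp \<rho>_\<iota>)
    then have "g (\<rho> k \<gamma>) = \<rho> k' (g \<gamma>)" for \<gamma> by (simp add: fun_eq_iff)
    from this[of "inv' g \<omega>"] have "g (\<rho> k (inv' g \<omega>)) = \<omega>"
      using \<rho>_stab[OF kA(2)] k'(1) g by (simp add: P.inv_apply)
    then have "\<rho> k (inv' g \<omega>) = inv' g \<omega>" using P.inv_eq_iff[OF g] by metis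
    moreover have "\<rho> k \<omega> = \<omega>" using \<rho>_stab[OF kA(1)] k by simp
    ultimately have "(\<rho> a \<alpha>, \<rho> a \<beta>) = (z \<omega>, z (inv' g \<omega>))" using act x by simp
    then show ?thesis using z by (auto simp: orbital.orb_def)
  qed

  \<comment> \<open>a permutation normalizing \<open>T\<close> induces an automorphism \<open>a\<close> of \<open>T\<close>, and \<open>\<rho> a\<close> induces it too,
    because \<open>\<rho>\<close> maps the inner automorphism of \<open>t\<close> to \<open>t\<close>\<close>
  have induces: "\<exists>a\<in>\<rho> ` carrier A. \<forall>t\<in>T. a \<circ> t \<circ> inv' a = p \<circ> t \<circ> inv' p"
    if p: "p permutes {1..n}" and norm: "\<forall>t\<in>T. p \<circ> t \<circ> inv' p \<in> T" for p
  proof -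
    have pS: "p \<in> carrier ?S" using p by (simp add: sym_group_carrier)
    define a where "a = conj_map ?S T p"
    have "carrier ?S = {p. p permutes {1..n}}" by (auto simp: sym_group_carrier)
    then have "finite (carrier ?S)" by (simp add: finite_permutations)
    then have aA: "a \<in> carrier A"
      using S.conj_map_in_AutoGroup[OF _ T pS] norm pS by (simp add: a_def A_def sym_group_mult)
    have at: "a t = p \<circ> t \<circ> inv' p" if "t \<in> T" for t
      using that pS by (simp add: a_def conj_map_def sym_group_mult)
    have "\<rho> a \<circ> t \<circ> inv' (\<rho> a) = p \<circ> t \<circ> inv' p" if t: "t \<in> T" for t
    proof -
      have atT: "a t \<in> T" using at norm t by simp
      have "a \<otimes>\<^bsub>A\<^esub> \<iota> t = \<iota> (a t) \<otimes>\<^bsub>A\<^esub> a"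
        using S.AutoGroup_conj_map[OF T, of a t] aA t atT T_G \<iota>_eq \<iota>_carr
        by (simp add: A_def subset_iff)
      then have "\<rho> (a \<otimes>\<^bsub>A\<^esub> \<iota> t) = \<rho> (\<iota> (a t) \<otimes>\<^bsub>A\<^esub> a)" by simp
      then have "\<rho> a \<circ> t = a t \<circ> \<rho> a"
        using aA t atT T_G by (simp add: sym_group_mult \<rho>_comp \<rho>_\<iota> subset_iff)
      then have "\<rho> a \<circ> t \<circ> inv' (\<rho> a) = a t \<circ> (\<rho> a \<circ> inv' (\<rho> a))" by (simp add: comp_assoc)
      then show ?thesis using permutes_inv_o(1)[OF \<rho>_perm[OF aA]] at[OF t] by simp
    qed
    then show ?thesis using aA by blast
  qed

  let ?A' = "\<rho> ` carrier A"
  interpret orbital: labelled_orbital n G \<omega> "inv' g \<omega>" T ?A' P.moving_to_base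
  proof (intro labelled_orbital.intro saturated_orbital.intro saturated_orbital_axioms.intro
      labelled_orbital_axioms.intro)
    show "unpaired_orbital n G \<omega> (inv' g \<omega>)" by (rule orbital.unpaired_orbital_axioms)
    show "simple_group (?S\<lparr>carrier := T\<rparr>)" by (rule simple)
    show "\<not> comm_group (?S\<lparr>carrier := T\<rparr>)" by (rule nonab)
    show "subgroup ?A' ?S" by (rule \<rho>.img_is_subgroup)
    show "G \<subseteq> ?A'" using \<rho>_\<iota> \<iota>_carr by (metis image_eqI subsetI)
    show "(a \<alpha>, a \<beta>) \<in> orbital.orb" if "a \<in> ?A'" "(\<alpha>, \<beta>) \<in> orbital.orb" for a \<alpha> \<beta>
      using that preserves by blast
    show "\<exists>a\<in>?A'. \<forall>t\<in>T. a \<circ> t \<circ> inv' a = p \<circ> t \<circ> inv' p"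
      if "p permutes {1..n}" "\<forall>t\<in>T. p \<circ> t \<circ> inv' p \<in> T" for p
      using induces[OF that] .
    show "socle (?S\<lparr>carrier := Y\<rparr>) = T"
      if "subgroup Y ?S" "G \<subseteq> Y" "Y \<noteq> carrier (alt_group n)" "Y \<noteq> carrier ?S" for Y
      using b that by blast
    show "inj_on P.moving_to_base {1..n}" by (rule P.inj_moving_to_base)
  qed

  have "bicoset_graph PG H H (double_coset PG H g H) = orbital.\<Gamma>"
    using P.bicoset_graph_eq[OF g]
    by (simp add: PG_def H_eq orbital.orb_def)
  moreover have "A \<cong> GraphAutoGroup orbital.\<Gamma>"
  proof -
    have "\<rho> \<in> iso A (?S\<lparr>carrier := ?A'\<rparr>)"
      using \<rho>_inj \<rho>_hom by (auto simp: iso_def hom_def bij_betw_def)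
    then show ?thesis using orbital.lift_iso by (meson is_isoI iso_trans)
  qed
  ultimately show ?thesis using orbital.semisymmetric_\<Gamma> A.iso_sym by simp
qed

end
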